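(* For $x>0$ and $k\ge 1$ let $$\mathcal{S}_k(x)= \left\{(y_1,\dots,y_k)\in\mathbb{R}^k : y_1 > \tfrac{1}{x},\ldots, y_k > \tfrac{1}{x},\ \sum_{j=1}^k y_j < 1\right\}.$$ (i) Let $\theta>0$ and let $\mathcal{T}_n^{\theta}$ be a Hoppe tree on $n$ nodes with root weight $\theta$. Then $\frac{\nu_n(\mathcal{T}_n^{\theta})}{n}$ converges weakly, as $n\to\infty$, to a random variable whose cumulative distribution function is given by $$F_{\theta}(x) = e^{\gamma \theta} x^{\theta - 1} \Gamma(\theta)\, p_{\theta}(1/x), \quad x > 0,$$ where $\gamma$ is Euler's constant and $$p_{\theta}(x) = \frac{e^{- \gamma \theta} x^{\theta - 1}}{\Gamma(\theta)} \left(1 + \sum_{k=1}^{\infty} \frac{(- \theta)^k}{k!} \int \cdots \int_{\mathcal{S}_k(x)} \Big(1 - \sum_{j=1}^k y_j \Big)^{\theta - 1} \frac{d y_1 \cdots d y_k}{y_1 \cdots y_k}\right).$$ (ii) Let $\mathcal{T}_n$ be a uniform recursive tree on $n$ nodes (the case $\theta=1$). Then $\frac{\nu_n(\mathcal{T}_n)}{n}$ converges weakly, as $n\to\infty$, to a random variable $\nu$ whose cumulative distribution function is $$F_1(x) = \begin{cases} 0, & x\le 0, \\ 1 + \displaystyle\sum_{k=1}^{\infty} \frac{(-1)^k}{k!} \int \cdots \int_{\mathcal{S}_k(1/x)} \frac{dy_1\cdots dy_k}{y_1\cdots y_k}, & 0<x\le 1, \\ 1, & x >1. \end{cases}$$ Moreover,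 for any $c \in [\frac12,1]$, $$\lim_{n \to \infty} \mathbb{P}(\nu_n(\mathcal{T}_n) \leq c n) = 1 - \ln (c^{-1}).$$ In particular, $\mathbb{E}[\nu] \geq \frac{1}{2}$.
   Context: Hoppe tree: for $\theta>0$, the Hoppe tree $\mathcal{T}_n^\theta$ is the random rooted tree on nodes $1,\dots,n$ with root $1$, in which, for $i=2,\dots,n$ successively and independently of the previous steps, node $i$ is attached as a child to the root with probability $\frac{\theta}{\theta+i-2}$ and to each of the nodes $2,\dots,i-1$ with probability $\frac{1}{\theta+i-2}$. For $\theta=1$ this is the uniform recursive tree $\mathcal{T}_n$, in which node $i$ chooses its parent uniformly among $1,\dots,i-1$. A branch of a rooted tree is a child of the root together with all of its descendants; its size is its number of nodes. For a tree $\mathcal{T}$ on $n$ nodes, $\nu_n(\mathcal{T})$ denotes the number of nodes in its largest branch. *)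

theory Defs
  imports "HOL-Probability.Probability"
begin

text \<open>
  A recursive tree on the nodes \<open>1, \<dots>, n\<close> with root \<open>1\<close> is encoded by its parent function:
  \<open>T i\<close> is the parent of node \<open>i\<close> for \<open>2 \<le> i \<le> n\<close>, and \<open>T i = 0\<close> (no parent) for all other \<open>i\<close>.
\<close>

definition hoppe_parent :: "real \<Rightarrow> nat \<Rightarrow> nat pmf" where
  "hoppe_parent \<theta> i = embed_pmf (\<lambda>j.
     if j = 1 then \<theta> / (\<theta> + real i - 2)
     else if j \<in> {2..<i} then 1 / (\<theta> + real i - 2)
     else 0)"

text \<open>
  \<^const>\<open>embed_pmf\<close> is meaningful only for nonnegative weights of total mass \<open>1\<close>; this holds here.
\<close>

lemma pmf_hoppe_parent:
  assumes "\<theta> > 0" "i \<ge> 2"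
  shows "pmf (hoppe_parent \<theta> i) j =
    (if j = 1 then \<theta> / (\<theta> + real i - 2)
     else if j \<in> {2..<i} then 1 / (\<theta> + real i - 2)
     else 0)"
proof -
  define w where "w = (\<lambda>j. if j = 1 then \<theta> / (\<theta> + real i - 2)
     else if j \<in> {2..<i} then 1 / (\<theta> + real i - 2) else 0)"
  have pos: "\<theta> + real i - 2 > 0"
    using assms by linarith
  have nonneg: "w j \<ge> 0" for j
    using pos assms(1) by (simp add: w_def)
  have "(\<integral>\<^sup>+ j. ennreal (w j) \<partial>count_space UNIV) = (\<Sum>j\<in>insert 1 {2..<i}. ennreal (w j))"
    by (intro nn_integral_count_space') (auto simp: w_def)
  also have "\<dots> = ennreal (\<Sum>j\<in>insert 1 {2..<i}. w j)"
    using nonneg by (intro sum_ennreal) auto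
  also have "(\<Sum>j\<in>insert 1 {2..<i}. w j) = w 1 + (\<Sum>j\<in>{2..<i}. w j)"
    by (subst sum.insert) auto
  also have "(\<Sum>j\<in>{2..<i}. w j) = (\<Sum>j\<in>{2..<i}. 1 / (\<theta> + real i - 2))"
    by (intro sum.cong) (auto simp: w_def)
  also have "w 1 + \<dots> = (\<theta> + (real i - 2)) / (\<theta> + real i - 2)"
    using assms(2) by (simp add: w_def of_nat_diff add_divide_distrib)
  also have "\<dots> = 1"
    using pos by simp
  finally have total: "(\<integral>\<^sup>+ j. ennreal (w j) \<partial>count_space UNIV) = 1"
    by simp
  have "pmf (embed_pmf w) j = w j"
    by (rule pmf_embed_pmf[OF nonneg total])
  thus ?thesis
    by (simp add: hoppe_parent_def w_def)
qed

definition hoppe_tree :: "real \<Rightarrow> nat \<Rightarrow> (nat \<Rightarrow> nat) pmf" where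
  "hoppe_tree \<theta> n = Pi_pmf {2..n} 0 (hoppe_parent \<theta>)"

definition uniform_recursive_tree :: "nat \<Rightarrow> (nat \<Rightarrow> nat) pmf" where
  "uniform_recursive_tree n = Pi_pmf {2..n} 0 (\<lambda>i. pmf_of_set {1..<i})"

lemma uniform_recursive_tree_eq_hoppe_tree: "uniform_recursive_tree n = hoppe_tree 1 n"
proof -
  have "pmf_of_set {1..<i} = hoppe_parent 1 i" if "i \<in> {2..n}" for i
  proof (rule pmf_eqI)
    fix j
    have i: "i \<ge> 2"
      using that by simp
    have "real (i - Suc 0) = real i - 1"
      using i by (simp add: of_nat_diff)
    then show "pmf (pmf_of_set {1..<i}) j = pmf (hoppe_parent 1 i) j"
      using i by (auto simp: pmf_hoppe_parent indicator_def)
  qed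
  thus ?thesis
    unfolding uniform_recursive_tree_def hoppe_tree_def by (intro Pi_pmf_cong) auto
qed

definition children :: "nat \<Rightarrow> (nat \<Rightarrow> nat) \<Rightarrow> nat \<Rightarrow> nat set" where
  "children n T v = {i \<in> {2..n}. T i = v}"

text \<open>The node \<open>c\<close> together with all of its descendants.\<close>

definition subtree_nodes :: "nat \<Rightarrow> (nat \<Rightarrow> nat) \<Rightarrow> nat \<Rightarrow> nat set" where
  "subtree_nodes n T c = {j. (c, j) \<in> {(v, i). i \<in> children n T v}\<^sup>*}"

text \<open>
  The inserted \<open>0\<close> only matters for \<open>n \<le> 1\<close>, where there are no branches.
\<close>

definition largest_branch :: "nat \<Rightarrow> (nat \<Rightarrow> nat) \<Rightarrow> nat" where
  "largest_branch n T = Max (insert 0 ((\<lambda>c. card (subtree_nodes n T c)) ` children n T 1))"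

text \<open>
  Points \<open>(y\<^sub>1, \<dots>, y\<^sub>k)\<close> of \<open>\<real>\<^sup>k\<close> are the elements of the space of the product measure
  \<open>Pi\<^sub>M {1..k} (\<lambda>_. lborel)\<close>, that is, functions on \<open>{1..k}\<close> extended by \<^const>\<open>undefined\<close>.
\<close>

definition simplex_region :: "nat \<Rightarrow> real \<Rightarrow> (nat \<Rightarrow> real) set" where
  "simplex_region k x =
     {y \<in> {1..k} \<rightarrow>\<^sub>E UNIV. (\<forall>j\<in>{1..k}. y j > 1 / x) \<and> (\<Sum>j=1..k. y j) < 1}"

text \<open>
  The sums over \<open>k \<ge> 1\<close> below are shifted to start at \<open>0\<close>. For \<open>x > 0\<close> they have only finitely
  many nonzero terms, since \<open>simplex_region k x\<close> is empty for \<open>k \<ge> x\<close>.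
\<close>

definition p_theta :: "real \<Rightarrow> real \<Rightarrow> real" where
  "p_theta \<theta> x = exp (- euler_mascheroni * \<theta>) * x powr (\<theta> - 1) / Gamma \<theta> *
     (1 + (\<Sum>m. let k = Suc m in (- \<theta>) ^ k / fact k *
        (LINT y:simplex_region k x|Pi\<^sub>M {1..k} (\<lambda>_. lborel).
           (1 - (\<Sum>j=1..k. y j)) powr (\<theta> - 1) / (\<Prod>j=1..k. y j))))"

definition F_theta :: "real \<Rightarrow> real \<Rightarrow> real" where
  "F_theta \<theta> x = exp (euler_mascheroni * \<theta>) * x powr (\<theta> - 1) * Gamma \<theta> * p_theta \<theta> (1 / x)"

definition F_one :: "real \<Rightarrow> real" where
  "F_one x =
     (if x \<le> 0 then 0
      else if x \<le> 1 then
        1 + (\<Sum>m. let k = Suc m in (- 1) ^ k / fact k *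
          (LINT y:simplex_region k (1 / x)|Pi\<^sub>M {1..k} (\<lambda>_. lborel). 1 / (\<Prod>j=1..k. y j)))
      else 1)"

end

(*
  If node n + 1 chooses its parent, either a new branch of size 1 appears (weight theta) or a branch
  of size b grows by one (weight b).  Hence, with r_N =
    theta (theta + 1) ... (theta + N - 1) / N!, the
  expectation of the product of u(b) over all branch sizes b of the tree on N + 1 nodes is
  [z^N] exp(theta * sum_j u(j) z^j / j) / r_N.  For u(j) =
    1 if j <= m, and 0 otherwise, the series is
  (1 - z)^(-theta) * exp(-theta * sum_{j > m} z^j / j), and expanding the exponential gives

    P(largest branch <= m) = sum_k (-theta)^k / k! *
      sum over j_1, ..., j_k > m of 1 / (j_1 ... j_k) * r_{N - j_1 - ... - j_k} / r_N.

  For m ~ x N only the terms with k <= 1 / x survive, and since r_N ~ N^(theta - 1) /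
    Gamma(theta) the
  inner sums are Riemann sums of the integrals in F_theta; dominated convergence yields the limit.
*)
theory Submission
  imports Defs
begin

subsection \<open>The branches of a recursive tree\<close>

text \<open>Every coefficient in the expansion is written exactly as the integral over R^k of a step
  function, so that the passage to the limit becomes dominated convergence and no error terms of
  Riemann sums have to be estimated. The obstacle is the face where the coordinates sum to 1. For
  \<theta> < 1 the limiting integrand is unbounded there, and a step function that reached beyond
  the face would not be covered by a majorant supported on the simplex. This dictates the scale n +
  k of the lattice, and a majorant that adds the constant 1, for \<theta> \<ge> 1, to the singular
  power, for \<theta> < 1. A second gap remains: convergence at every x > 0 would still allow mass
  to collapse to 0, and the series says little there because its number of terms grows like 1/x. A
  separate linear bound on \<open>F_theta\<close> near 0 closes this gap and makes the limiting
  function a distribution function.\<close>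

definition child_edges :: "nat \<Rightarrow> (nat \<Rightarrow> nat) \<Rightarrow> (nat \<times> nat) set" where
  "child_edges n T = {(v, i). i \<in> children n T v}"

definition is_recursive_tree :: "nat \<Rightarrow> (nat \<Rightarrow> nat) \<Rightarrow> bool" where
  "is_recursive_tree n T \<longleftrightarrow> (\<forall>i\<in>{2..n}. 1 \<le> T i \<and> T i < i)"

definition branch_size :: "nat \<Rightarrow> (nat \<Rightarrow> nat) \<Rightarrow> nat \<Rightarrow> nat" where
  "branch_size n T c = card (subtree_nodes n T c)"

lemma subtree_nodes_eq: "subtree_nodes n T c = {j. (c, j) \<in> (child_edges n T)\<^sup>*}"
  by (simp add: subtree_nodes_def child_edges_def)

lemma finite_children [simp]: "finite (children n T v)"
  by (simp add: children_def)

text \<open>Parents have smaller labels than their children, so labels only grow on the way down.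
  The start \<open>c\<close> need not be a node of the tree, hence the alternative
  \<open>j = c\<close>.\<close>

lemma subtree_nodes_bounds:
  assumes "is_recursive_tree n T" "j \<in> subtree_nodes n T c"
  shows "c \<le> j" and "j = c \<or> j \<in> {2..n}"
proof -
  have "(c, j) \<in> (child_edges n T)\<^sup>*"
    using assms(2) by (simp add: subtree_nodes_eq)
  then have "c \<le> j \<and> (j = c \<or> j \<in> {2..n})"
  proof (induction rule: rtrancl_induct)
    case (step y z)
    then have "z \<in> {2..n}" "T z = y"
      by (auto simp: child_edges_def children_def)
    moreover from this assms(1) have "T z < z"
      by (auto simp: is_recursive_tree_def)
    ultimately show ?case
      using step.IH by auto
  qed auto
  then show "c \<le> j" and "j = c \<or> j \<in> {2..n}"
    by auto
qed

lemma subtree_nodes_subset: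
  assumes "is_recursive_tree n T" "c \<in> children n T v"
  shows "subtree_nodes n T c \<subseteq> {2..n}"
  using subtree_nodes_bounds(2)[OF assms(1)] assms(2) by (fastforce simp: children_def)

lemma subtree_nodes_refl: "c \<in> subtree_nodes n T c"
  by (simp add: subtree_nodes_eq)

lemma subtree_nodes_rec:
  assumes "p \<in> {2..n}"
  shows "p \<in> subtree_nodes n T c \<longleftrightarrow> p = c \<or> T p \<in> subtree_nodes n T c"
proof -
  have "(c, p) \<in> (child_edges n T)\<^sup>* \<longleftrightarrow> p = c \<or> (c, T p) \<in> (child_edges n T)\<^sup>*"
  proof
    assume "(c, p) \<in> (child_edges n T)\<^sup>*"
    then show "p = c \<or> (c, T p) \<in> (child_edges n T)\<^sup>*"
      by (cases rule: rtranclE) (auto simp: child_edges_def children_def)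
  next
    have "(T p, p) \<in> child_edges n T"
      using assms by (simp add: child_edges_def children_def)
    then show "p = c \<or> (c, T p) \<in> (child_edges n T)\<^sup>* \<Longrightarrow> (c, p) \<in> (child_edges n T)\<^sup>*"
      by (auto intro: rtrancl_into_rtrancl)
  qed
  then show ?thesis
    by (simp add: subtree_nodes_eq)
qed

text \<open>Walking up from \<open>p\<close> strictly decreases the label and must end at a child of
  the root, which is the required branch. Disjointness and covering of the branches both follow from
  this fact.\<close>

lemma ex1_branch:
  assumes "is_recursive_tree n T" "p \<in> {2..n}"
  shows "\<exists>!c. c \<in> children n T 1 \<and> p \<in> subtree_nodes n T c"
  using assms(2)
proof (induction p rule: less_induct)
  case (less p)
  have Tp: "1 \<le> T p" "T p < p"
    using assms(1) less.prems by (auto simp: is_recursive_tree_def)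
  have gt: "c \<ge> 2" if "c \<in> children n T 1" for c
    using that by (simp add: children_def)
  show ?case
  proof (cases "T p = 1")
    case True
    have "c = p" if "c \<in> children n T 1" "p \<in> subtree_nodes n T c" for c
      using that subtree_nodes_rec[OF less.prems] True gt[OF that(1)]
        subtree_nodes_bounds(1)[OF assms(1), of 1 c] by auto
    moreover have "p \<in> children n T 1"
      using True less.prems by (simp add: children_def)
    ultimately show ?thesis
      using subtree_nodes_refl by blast
  next
    case False
    then have "p \<notin> children n T 1"
      by (simp add: children_def)
    then have "c \<in> children n T 1 \<and> p \<in> subtree_nodes n T c \<longleftrightarrow>
        c \<in> children n T 1 \<and> T p \<in> subtree_nodes n T c" for c
      using subtree_nodes_rec[OF less.prems] by auto
    moreover have "T p \<in> {2..n}"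
      using False Tp less.prems by auto
    ultimately show ?thesis
      using less.IH[of "T p"] Tp by simp
  qed
qed

lemma disjoint_branches:
  assumes "is_recursive_tree n T" "c \<in> children n T 1" "d \<in> children n T 1" "c \<noteq> d"
  shows "subtree_nodes n T c \<inter> subtree_nodes n T d = {}"
proof -
  have "c = d" if "p \<in> subtree_nodes n T c" "p \<in> subtree_nodes n T d" for p
    using ex1_branch[OF assms(1), of p] subtree_nodes_subset[OF assms(1,2)] that assms(2,3) by blast
  with assms(4) show ?thesis
    by auto
qed

lemma union_branches:
  assumes "is_recursive_tree n T"
  shows "(\<Union>c\<in>children n T 1. subtree_nodes n T c) = {2..n}"
  using ex1_branch[OF assms] subtree_nodes_subset[OF assms] by blast

section \<open>Attaching one more node to a tree\<close>

lemma child_edges_insert: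
  assumes "1 \<le> n"
  shows "child_edges (Suc n) (T(Suc n := p)) = insert (p, Suc n) (child_edges n T)"
  using assms by (auto simp: child_edges_def children_def)

lemma children_insert:
  assumes "1 \<le> n"
  shows "children (Suc n) (T(Suc n := p)) v = (if p =
    v then insert (Suc n) (children n T v) else children n T v)"
  using assms by (auto simp: children_def)

lemma subtree_nodes_new:
  assumes "is_recursive_tree n T"
  shows "subtree_nodes n T (Suc n) = {Suc n}"
  using subtree_nodes_bounds[OF assms, of _ "Suc n"] subtree_nodes_refl by fastforce

text \<open>Branches are reachability sets, so attaching a node adds a single edge to a relation,
  and the closure changes only by paths through this edge. From the new node only the node itself is
  reachable, by \<open>subtree_nodes_new\<close>.\<close>

lemma subtree_nodes_insert:
  assumes "is_recursive_tree n T" "1 \<le> n"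
  shows "subtree_nodes (Suc n) (T(Suc n := p)) c =
    (if p \<in> subtree_nodes n T c then insert (Suc n) (subtree_nodes n T c) else subtree_nodes n T c)"
  using subtree_nodes_new[OF assms(1)]
  by (auto simp: subtree_nodes_eq child_edges_insert[OF assms(2)] rtrancl_insert)

lemma branch_size_insert:
  assumes "is_recursive_tree n T" "1 \<le> n" "c \<in> children n T 1"
  shows "branch_size (Suc n) (T(Suc n := p)) c =
    (if p \<in> subtree_nodes n T c then Suc (branch_size n T c) else branch_size n T c)"
  using subtree_nodes_subset[OF assms(1,3)]
  by (auto simp: branch_size_def subtree_nodes_insert[OF assms(1,2)] finite_subset card_insert_if)

lemma branch_size_new:
  assumes "is_recursive_tree n T" "1 \<le> n" "p \<le> n"
  shows "branch_size (Suc n) (T(Suc n := p)) (Suc n) = 1"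
  using assms by (simp add: branch_size_def subtree_nodes_insert subtree_nodes_new)

definition branch_prod :: "(nat \<Rightarrow> real) \<Rightarrow> nat \<Rightarrow> (nat \<Rightarrow> nat) \<Rightarrow> real" where
  "branch_prod u n T = (\<Prod>c\<in>children n T 1. u (branch_size n T c))"

text \<open>Directional derivative of \<open>branch_prod\<close> at the weights \<open>u\<close> in
  direction \<open>w\<close>, written out by the product rule.\<close>

definition branch_prod_deriv :: "(nat \<Rightarrow> real) \<Rightarrow> (nat \<Rightarrow> real) \<Rightarrow> nat \<Rightarrow> (nat \<Rightarrow> nat) \<Rightarrow> real" where
  "branch_prod_deriv u w n T = (\<Sum>c\<in>children n T 1. w (branch_size n T c) *
     (\<Prod>d\<in>children n T 1 - {c}. u (branch_size n T d)))"

lemma branch_prod_insert_root: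
  assumes "is_recursive_tree n T" "1 \<le> n"
  shows "branch_prod u (Suc n) (T(Suc n := 1)) = u 1 * branch_prod u n T"
proof -
  have "1 \<notin> subtree_nodes n T c" if "c \<in> children n T 1" for c
    using subtree_nodes_subset[OF assms(1) that] by auto
  then have *: "(\<Prod>c\<in>children n T 1. u (branch_size (Suc n) (T(Suc n := 1)) c)) =
      (\<Prod>c\<in>children n T 1. u (branch_size n T c))"
    by (intro prod.cong) (auto simp: branch_size_insert[OF assms])
  have "children (Suc n) (T(Suc n := 1)) 1 = insert (Suc n) (children n T 1)"
    "Suc n \<notin> children n T 1"
    by (simp_all add: children_insert[OF assms(2)]) (simp add: children_def)
  with * branch_size_new[OF assms, of 1] assms(2) show ?thesis
    by (simp add: branch_prod_def)
qed

lemma branch_prod_insert_branch: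
  assumes "is_recursive_tree n T" "1 \<le> n" "c \<in> children n T 1" "p \<in> subtree_nodes n T c"
  shows "branch_prod u (Suc n) (T(Suc n := p)) =
    u (Suc (branch_size n T c)) * (\<Prod>d\<in>children n T 1 - {c}. u (branch_size n T d))"
proof -
  have "p \<noteq> 1"
    using subtree_nodes_subset[OF assms(1,3)] assms(4) by auto
  then have "branch_prod u (Suc n) (T(Suc n := p)) =
      (\<Prod>d\<in>children n T 1. u (branch_size (Suc n) (T(Suc n := p)) d))"
    by (simp add: branch_prod_def children_insert[OF assms(2)])
  also have "\<dots> = u (branch_size (Suc n) (T(Suc n := p)) c) *
      (\<Prod>d\<in>children n T 1 - {c}. u (branch_size (Suc n) (T(Suc n := p)) d))"
    by (rule prod.remove[OF _ assms(3)]) simp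
  also have "(\<Prod>d\<in>children n T 1 - {c}. u (branch_size (Suc n) (T(Suc n := p)) d)) =
      (\<Prod>d\<in>children n T 1 - {c}. u (branch_size n T d))"
  proof (intro prod.cong refl)
    fix d assume d: "d \<in> children n T 1 - {c}"
    then have "p \<notin> subtree_nodes n T d"
      using disjoint_branches[OF assms(1,3), of d] assms(4) by auto
    then show "u (branch_size (Suc n) (T(Suc n := p)) d) = u (branch_size n T d)"
      using d branch_size_insert[OF assms(1,2)] by simp
  qed
  also have "branch_size (Suc n) (T(Suc n := p)) c = Suc (branch_size n T c)"
    using branch_size_insert[OF assms(1-3)] assms(4) by simp
  finally show ?thesis .
qed

text \<open>Each of the b nodes of a branch of size b is a possible parent, and each choice replaces
  the factor \<open>u b\<close> by \<open>u (Suc b)\<close>. Summed over the partition of the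
  non-root nodes into branches, this is a derivative in the direction j * u(j + 1).\<close>

lemma sum_branch_prod_insert:
  assumes "is_recursive_tree n T" "1 \<le> n"
  shows "(\<Sum>p\<in>{2..n}. branch_prod u (Suc n) (T(Suc n := p))) =
    branch_prod_deriv u (\<lambda>j. real j * u (Suc j)) n T"
proof -
  have "(\<Sum>p\<in>{2..n}. branch_prod u (Suc n) (T(Suc n := p))) =
      (\<Sum>c\<in>children n T 1. \<Sum>p\<in>subtree_nodes n T c. branch_prod u (Suc n) (T(Suc n := p)))"
    unfolding union_branches[OF assms(1), symmetric]
    using subtree_nodes_subset[OF assms(1)] disjoint_branches[OF assms(1)]
    by (intro sum.UNION_disjoint) (auto intro: finite_subset)
  also have "\<dots> = branch_prod_deriv u (\<lambda>j. real j * u (Suc j)) n T"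
    unfolding branch_prod_deriv_def
    by (intro sum.cong) (auto simp: branch_prod_insert_branch[OF assms] branch_size_def)
  finally show ?thesis .
qed

section \<open>Expectations over the random tree\<close>

lemma set_pmf_hoppe_parent:
  assumes "\<theta> > 0" "i \<ge> 2"
  shows "set_pmf (hoppe_parent \<theta> i) = {1..<i}"
  using assms by (auto simp: set_pmf_eq pmf_hoppe_parent)

lemma set_pmf_hoppe_tree:
  assumes "\<theta> > 0"
  shows "finite (set_pmf (hoppe_tree \<theta> n))"
    and "T \<in> set_pmf (hoppe_tree \<theta> n) \<Longrightarrow> is_recursive_tree n T"
proof -
  have eq: "set_pmf (hoppe_tree \<theta> n) = PiE_dflt {2..n} 0 (set_pmf \<circ> hoppe_parent \<theta>)"
    by (simp add: hoppe_tree_def set_Pi_pmf)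
  show "finite (set_pmf (hoppe_tree \<theta> n))"
    unfolding eq by (intro finite_PiE_dflt) (auto simp: set_pmf_hoppe_parent assms)
  show "is_recursive_tree n T" if "T \<in> set_pmf (hoppe_tree \<theta> n)"
    using that assms unfolding eq
    by (auto simp: PiE_dflt_def is_recursive_tree_def set_pmf_hoppe_parent)
qed

lemma integrable_hoppe_tree:
  fixes f :: "(nat \<Rightarrow> nat) \<Rightarrow> real"
  assumes "\<theta> > 0"
  shows "integrable (measure_pmf (hoppe_tree \<theta> n)) f"
  by (intro integrable_measure_pmf_finite set_pmf_hoppe_tree assms)

text \<open>Peeling off the last coordinate of the product draws the new parent first; commuting the
  two independent draws puts the smaller tree first, so that the next lemma can condition on
  it.\<close>

lemma hoppe_tree_Suc:
  assumes "1 \<le> n"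
  shows "hoppe_tree \<theta> (Suc n) =
    hoppe_tree \<theta> n \<bind> (\<lambda>T. map_pmf (\<lambda>p. T(Suc n := p)) (hoppe_parent \<theta> (Suc n)))"
proof -
  have "{2..Suc n} = insert (Suc n) {2..n}"
    using assms by auto
  then have "hoppe_tree \<theta> (Suc n) =
    hoppe_parent \<theta> (Suc n) \<bind> (\<lambda>p. hoppe_tree \<theta> n \<bind> (\<lambda>T. return_pmf (T(Suc n := p))))"
    unfolding hoppe_tree_def by (simp add: Pi_pmf_insert')
  also have "\<dots> = hoppe_tree \<theta> n \<bind> (\<lambda>T. hoppe_parent \<theta> (Suc n) \<bind> (\<lambda>p. return_pmf (T(Suc n := p))))"
    by (rule bind_commute_pmf)
  finally show ?thesis
    by (simp add: map_pmf_def)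
qed

text \<open>Conditions on the tree with \<open>n\<close> nodes. The factor \<theta> + n - 1 is the
  total weight of its nodes, \<theta> for the root and 1 for each other node.\<close>

lemma expectation_branch_prod_Suc:
  assumes "\<theta> > 0" "1 \<le> n"
  shows "(\<theta> + real n - 1) * measure_pmf.expectation (hoppe_tree \<theta> (Suc n)) (branch_prod u (Suc n)) =
    \<theta> * u 1 * measure_pmf.expectation (hoppe_tree \<theta> n) (branch_prod u n) +
    measure_pmf.expectation (hoppe_tree \<theta> n) (branch_prod_deriv u (\<lambda>j. real j * u (Suc j)) n)"
proof -
  let ?f = "\<lambda>T. \<theta> * u 1 * branch_prod u n T + branch_prod_deriv u (\<lambda>j. real j * u (Suc j)) n T"
  let ?S = "set_pmf (hoppe_tree \<theta> n)"
  have pos: "\<theta> + real n - 1 > 0"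
    using assms by linarith
  have step: "measure_pmf.expectation (map_pmf (\<lambda>p. T(Suc n := p)) (hoppe_parent \<theta> (Suc n))) (branch_prod u (Suc n))
      = ?f T / (\<theta> + real n - 1)" if T: "T \<in> ?S" for T
  proof -
    note rt = set_pmf_hoppe_tree(2)[OF assms(1) T]
    have "measure_pmf.expectation (map_pmf (\<lambda>p. T(Suc n := p)) (hoppe_parent \<theta> (Suc n))) (branch_prod u (Suc n))
      = (\<Sum>p\<in>insert 1 {2..n}. pmf (hoppe_parent \<theta> (Suc n)) p *
        branch_prod u (Suc n) (T(Suc n := p)))"
      using assms by (subst integral_map_pmf, subst integral_measure_pmf[of "insert 1 {2..n}"])
        (auto simp: set_pmf_hoppe_parent)
    also have "\<dots> = \<theta> / (\<theta> + real n - 1) * branch_prod u (Suc n) (T(Suc n := 1)) +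
        (\<Sum>p\<in>{2..n}. 1 / (\<theta> + real n - 1) * branch_prod u (Suc n) (T(Suc n := p)))"
    proof -
      have "pmf (hoppe_parent \<theta> (Suc n)) 1 = \<theta> / (\<theta> + real n - 1)"
        using assms by (subst pmf_hoppe_parent) (auto simp: algebra_simps)
      moreover have "pmf (hoppe_parent \<theta> (Suc n)) p = 1 / (\<theta> + real n - 1)" if "p \<in> {2..n}" for p
        using assms that by (subst pmf_hoppe_parent) (auto simp: algebra_simps)
      ultimately show ?thesis
        by (subst sum.insert) auto
    qed
    also have "\<dots> = ?f T / (\<theta> + real n - 1)"
      by (simp only: sum_distrib_left[symmetric] branch_prod_insert_root[OF rt assms(2)]
           sum_branch_prod_insert[OF rt assms(2)]) (simp add: add_divide_distrib)
    finally show ?thesis .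
  qed
  have "measure_pmf.expectation (hoppe_tree \<theta> (Suc n)) (branch_prod u (Suc n)) =
      (\<Sum>T\<in>?S. pmf (hoppe_tree \<theta> n) T * (?f T / (\<theta> + real n - 1)))"
    unfolding hoppe_tree_Suc[OF assms(2)]
    using assms by (subst pmf_expectation_bind[of ?S])
      (auto simp del: integral_map_pmf map_pmf_rep_eq simp:
        set_pmf_hoppe_tree set_pmf_hoppe_parent step intro!: sum.cong)
  also have "\<dots> = measure_pmf.expectation (hoppe_tree \<theta> n) (\<lambda>T. ?f T / (\<theta> + real n - 1))"
    using assms by (subst integral_measure_pmf[of ?S]) (auto simp: set_pmf_hoppe_tree)
  also have "\<dots> = measure_pmf.expectation (hoppe_tree \<theta> n) ?f / (\<theta> + real n - 1)"
    by simp
  also have "measure_pmf.expectation (hoppe_tree \<theta> n) ?f =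
    \<theta> * u 1 * measure_pmf.expectation (hoppe_tree \<theta> n) (branch_prod u n) +
    measure_pmf.expectation (hoppe_tree \<theta> n) (branch_prod_deriv u (\<lambda>j. real j * u (Suc j)) n)"
    by (subst Bochner_Integration.integral_add) (auto intro!: integrable_hoppe_tree assms)
  finally show ?thesis
    using pos by (simp add: field_simps)
qed

lemma has_field_derivative_branch_prod:
  "((\<lambda>e. branch_prod (\<lambda>j. u j + e *
    w j) n T) has_field_derivative branch_prod_deriv u w n T) (at 0)"
  unfolding branch_prod_def branch_prod_deriv_def
  by (rule has_field_derivative_prod[where z = 0 and f =
    "\<lambda>c e. u (branch_size n T c) + e * w (branch_size n T c)", simplified])
     (auto intro!: derivative_eq_intros)

text \<open>The support is finite, so the expectation is a finite sum and may be differentiated term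
  by term.\<close>

lemma has_field_derivative_expectation_branch_prod:
  assumes "\<theta> > 0"
  shows "((\<lambda>e. measure_pmf.expectation (hoppe_tree \<theta> n) (branch_prod (\<lambda>j. u j + e * w j) n))
    has_field_derivative measure_pmf.expectation (hoppe_tree \<theta> n) (branch_prod_deriv u w n)) (at 0)"
proof -
  have *: "measure_pmf.expectation (hoppe_tree \<theta> n) f =
      (\<Sum>T\<in>set_pmf (hoppe_tree \<theta> n). pmf (hoppe_tree \<theta> n) T * f T)" for f :: "_ \<Rightarrow> real"
    using assms by (subst integral_measure_pmf[of "set_pmf (hoppe_tree \<theta> n)"]) (auto simp:
      set_pmf_hoppe_tree)
  show ?thesis
    unfolding * by (intro DERIV_sum DERIV_cmult has_field_derivative_branch_prod)
qed

subsection \<open>The exponential formula for the branch sizes\<close>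

unbundle no vec_syntax and fps_syntax

text \<open>At index 0 the quotient is \<open>u 0 / 0 = 0\<close>, so the constant term vanishes and
  composition with an exponential series is legitimate.\<close>

definition cycle_fps :: "(nat \<Rightarrow> real) \<Rightarrow> real fps" where
  "cycle_fps u = Abs_fps (\<lambda>j. u j / real j)"

text \<open>Here \<open>fps_exp \<theta>\<close> is the series of exp(\<theta> z). The n-th
  coefficient of the composition is also 1/n! times the sum over all permutations of n points of the
  product of \<theta> u(l) over the cycle lengths l, which is the Ewens weighting.\<close>

definition ewens_fps :: "real \<Rightarrow> (nat \<Rightarrow> real) \<Rightarrow> real fps" where
  "ewens_fps \<theta> u = fps_exp \<theta> oo cycle_fps u"

definition rising_coeff :: "real \<Rightarrow> nat \<Rightarrow> real" where
  "rising_coeff \<theta> n = pochhammer \<theta> n / fact n"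

lemma cycle_fps_nth [simp]: "cycle_fps u $ j = u j / real j"
  by (simp add: cycle_fps_def)

lemma ewens_fps_nth_0 [simp]: "ewens_fps \<theta> u $ 0 = 1"
  by (simp add: ewens_fps_def)

lemma fps_deriv_cycle_fps: "fps_deriv (cycle_fps u) = Abs_fps (\<lambda>j. u (Suc j))"
  by (rule fps_ext) simp

lemma fps_deriv_fps_exp_compose_cycle_fps:
  "fps_deriv (fps_exp \<theta> oo cycle_fps u) =
    fps_const \<theta> * Abs_fps (\<lambda>j. u (Suc j)) * (fps_exp \<theta> oo cycle_fps u)"
  by (simp add: fps_compose_deriv fps_deriv_cycle_fps fps_compose_mult_distrib)

lemma fps_deriv_ewens_fps:
  "fps_deriv (ewens_fps \<theta> u) = fps_const \<theta> * Abs_fps (\<lambda>j. u (Suc j)) * ewens_fps \<theta> u"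
  by (simp add: ewens_fps_def fps_deriv_fps_exp_compose_cycle_fps)

lemma fps_nth_Suc_eq_deriv: "f $ Suc n = fps_deriv f $ n / real (Suc n)"
  for f :: "real fps"
  by (simp del: of_nat_Suc)

lemma ewens_fps_nth_Suc:
  "ewens_fps \<theta> u $ Suc n = \<theta> * (\<Sum>i=0..n. u (Suc i) * ewens_fps \<theta> u $ (n - i)) / real (Suc n)"
  unfolding fps_nth_Suc_eq_deriv[of "ewens_fps \<theta> u"] fps_deriv_ewens_fps mult.assoc
  by (simp only: fps_mult_left_const_nth fps_mult_nth[of "Abs_fps _"] fps_nth_Abs_fps)

text \<open>Formally, differentiating exp(\<theta> C) with C affine in \<open>e\<close> multiplies
  it by \<theta> times the derivative of C. For coefficients this becomes a strong induction: the
  claimed derivative obeys the recursion \<open>ewens_fps_nth_Suc\<close> differentiated at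
  \<open>e = 0\<close>.\<close>

lemma has_field_derivative_ewens_fps_nth:
  "((\<lambda>e. ewens_fps \<theta> (\<lambda>j. u j + e * w j) $ n) has_field_derivative
    (fps_const \<theta> * cycle_fps w * ewens_fps \<theta> u) $ n) (at 0)"
proof (induction n rule: less_induct)
  case (less n)
  let ?G = "fps_const \<theta> * cycle_fps w * ewens_fps \<theta> u"
  show ?case
  proof (cases n)
    case 0
    then show ?thesis
      by simp
  next
    case (Suc k)
    have "fps_deriv ?G = fps_const \<theta> * (Abs_fps (\<lambda>j. w (Suc j)) * ewens_fps \<theta> u +
      Abs_fps (\<lambda>j. u (Suc j)) * ?G)"
      by (simp add: fps_deriv_cycle_fps fps_deriv_ewens_fps algebra_simps)
    then have "fps_deriv ?G $ k =
        \<theta> * (\<Sum>i=0..k. w (Suc i) * ewens_fps \<theta> u $ (k - i) + u (Suc i) * ?G $ (k - i))"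
      by (simp only: fps_mult_left_const_nth fps_add_nth fps_mult_nth[of "Abs_fps _"] fps_nth_Abs_fps sum.distrib)
    then have G: "?G $ n = \<theta> * (\<Sum>i=0..k. w (Suc i) * ewens_fps \<theta> u $ (k - i) + u (Suc i) *
      ?G $ (k - i)) / real (Suc k)"
      by (simp only: Suc fps_nth_Suc_eq_deriv[of ?G])
    have "((\<lambda>e. (u (Suc i) + e * w (Suc i)) * ewens_fps \<theta> (\<lambda>j. u j + e *
      w j) $ (k - i)) has_field_derivative
        w (Suc i) * ewens_fps \<theta> u $ (k - i) + u (Suc i) * ?G $ (k - i)) (at 0)" for i
      by (rule derivative_eq_intros less.IH refl | simp add: Suc)+
    then have "((\<lambda>e. \<theta> * (\<Sum>i=0..k. (u (Suc i) + e * w (Suc i)) * ewens_fps \<theta> (\<lambda>j. u j + e *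
      w j) $ (k - i)) / real (Suc k))
        has_field_derivative ?G $ n) (at 0)"
      unfolding G by (intro DERIV_cdivide DERIV_cmult DERIV_sum)
    then show ?thesis
      by (simp only: Suc ewens_fps_nth_Suc)
  qed
qed

lemma rising_coeff_0 [simp]: "rising_coeff \<theta> 0 = 1"
  by (simp add: rising_coeff_def)

lemma rising_coeff_Suc: "rising_coeff \<theta> (Suc n) = rising_coeff \<theta> n * (\<theta> + real n) / real (Suc n)"
  by (simp add: rising_coeff_def pochhammer_Suc)

lemma rising_coeff_pos: "\<theta> > 0 \<Longrightarrow> rising_coeff \<theta> n > 0"
  by (simp add: rising_coeff_def pochhammer_pos)

text \<open>
  The one-step recursion of the tree leads from \<^term>\<open>branch_prod\<close> to \<^term>\<open>branch_prod_deriv\<close>,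
    whose expectation is obtained by
  differentiating the induction hypothesis with respect to the weights.
\<close>

theorem expectation_branch_prod:
  assumes "\<theta> > 0"
  shows "measure_pmf.expectation (hoppe_tree \<theta> (Suc n)) (branch_prod u (Suc n)) * rising_coeff \<theta> n =
    ewens_fps \<theta> u $ n"
proof (induction n arbitrary: u)
  case 0
  have "branch_prod u (Suc 0) = (\<lambda>T. 1)"
    by (auto simp: branch_prod_def children_def)
  then show ?case
    by simp
next
  case (Suc n)
  let ?E = "\<lambda>f. measure_pmf.expectation (hoppe_tree \<theta> (Suc n)) f"
  define w where "w = (\<lambda>j. real j * u (Suc j))"
  have "((\<lambda>e. ?E (branch_prod (\<lambda>j. u j + e * w j) (Suc n)) * rising_coeff \<theta> n) has_field_derivative
      ?E (branch_prod_deriv u w (Suc n)) * rising_coeff \<theta> n) (at 0)"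
    by (intro DERIV_cmult_right has_field_derivative_expectation_branch_prod assms)
  moreover have "((\<lambda>e. ?E (branch_prod (\<lambda>j. u j + e * w j) (Suc n)) *
    rising_coeff \<theta> n) has_field_derivative
      (fps_const \<theta> * cycle_fps w * ewens_fps \<theta> u) $ n) (at 0)"
    unfolding Suc.IH by (rule has_field_derivative_ewens_fps_nth)
  ultimately have D: "?E (branch_prod_deriv u w (Suc n)) * rising_coeff \<theta> n =
      (fps_const \<theta> * cycle_fps w * ewens_fps \<theta> u) $ n"
    by (rule DERIV_unique)
  \<comment> \<open>For j \<ge> 1 the quotient \<open>w j / j\<close> is \<open>u (Suc j)\<close>,
    and at index 0 it is 0; the missing constant \<open>u 1\<close> is the contribution of a new
    branch.\<close>
  have w: "Abs_fps (\<lambda>j. u (Suc j)) = fps_const (u 1) + cycle_fps w"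
    by (rule fps_ext) (auto simp: w_def)
  have "(\<theta> + real n) * measure_pmf.expectation (hoppe_tree \<theta> (Suc (Suc n))) (branch_prod u (Suc (Suc n))) *
      rising_coeff \<theta> n = \<theta> * u 1 * ewens_fps \<theta> u $ n + (fps_const \<theta> * cycle_fps w *
        ewens_fps \<theta> u) $ n"
    using expectation_branch_prod_Suc[OF assms, of "Suc n" u] D[unfolded w_def]
    by (simp add: Suc.IH[symmetric] algebra_simps w_def)
  also have "\<dots> = (fps_const \<theta> * Abs_fps (\<lambda>j. u (Suc j)) * ewens_fps \<theta> u) $ n"
    by (simp add: w algebra_simps)
  also have "\<dots> = real (Suc n) * ewens_fps \<theta> u $ Suc n"
    by (simp add: fps_deriv_ewens_fps[symmetric])
  finally show ?case
    by (simp add: rising_coeff_Suc field_simps del: of_nat_Suc)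
qed

section \<open>Truncated weights\<close>

lemma largest_branch_le_iff:
  "largest_branch n T \<le> m \<longleftrightarrow> (\<forall>c\<in>children n T 1. branch_size n T c \<le> m)"
  by (auto simp: largest_branch_def branch_size_def)

lemma prob_largest_branch_le:
  assumes "\<theta> > 0"
  shows "measure_pmf.prob (hoppe_tree \<theta> (Suc n)) {T. largest_branch (Suc n) T \<le> m} =
    ewens_fps \<theta> (\<lambda>j. if j \<le> m then 1 else 0) $ n / rising_coeff \<theta> n"
proof -
  have "branch_prod (\<lambda>j. if j \<le> m then 1 else 0) (Suc n) = indicator {T. largest_branch (Suc n) T \<le>
    m}"
    by (auto simp: branch_prod_def largest_branch_le_iff indicator_def prod.neutral)
  then show ?thesis
    using expectation_branch_prod[OF assms, of n "\<lambda>j. if j \<le>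
      m then 1 else 0"] rising_coeff_pos[OF assms, of n]
    by (simp add: field_simps)
qed

text \<open>The coefficient of z^k in the equation determines coefficient k + 1 from the earlier
  ones, so a linear first-order equation and the constant term fix the series. This lets
  \<open>ewens_fps_truncated\<close> avoid formal logarithms.\<close>

lemma fps_eqI_deriv:
  fixes f g c :: "'a::field_char_0 fps"
  assumes "fps_deriv f = c * f" "fps_deriv g = c * g" "f $ 0 = g $ 0"
  shows "f = g"
proof (rule fps_ext)
  fix n
  show "f $ n = g $ n"
  proof (induction n rule: less_induct)
    case (less n)
    show ?case
    proof (cases n)
      case (Suc k)
      have "of_nat (Suc k) * f $ Suc k = (c * f) $ k"
        using assms(1)[symmetric] by simp
      also have "\<dots> = (c * g) $ k"
        using less.IH Suc by (auto simp: fps_mult_nth intro!: sum.cong)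
      also have "\<dots> = of_nat (Suc k) * g $ Suc k"
        using assms(2)[symmetric] by simp
      finally show ?thesis
        using Suc by (simp del: of_nat_Suc)
    qed (use assms in simp)
  qed
qed

text \<open>Coefficient form of R' = \<theta> R / (1 - z) for R = (1 - z)^(-\<theta>).\<close>

lemma sum_rising_coeff:
  "\<theta> * (\<Sum>i=0..n. rising_coeff \<theta> i) = real (Suc n) * rising_coeff \<theta> (Suc n)"
proof (induction n)
  case (Suc n)
  have "\<theta> * (\<Sum>i=0..Suc n. rising_coeff \<theta> i) = (real (Suc n) + \<theta>) * rising_coeff \<theta> (Suc n)"
    using Suc.IH by (simp add: algebra_simps)
  then show ?case
    by (simp add: rising_coeff_Suc[of _ "Suc n"] del: of_nat_Suc)
qed (simp add: rising_coeff_Suc)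

text \<open>Both sides satisfy f' = \<theta> (1 + z + ... + z^(m-1)) f and have constant term 1. On
  the right, the second factor contributes \<theta> / (1 - z), and the exponential removes the
  powers from z^m on.\<close>

lemma ewens_fps_truncated:
  "ewens_fps \<theta> (\<lambda>j. if j \<le> m then 1 else 0) =
    (fps_exp (- \<theta>) oo cycle_fps (\<lambda>j. if j > m then 1 else 0)) * Abs_fps (rising_coeff \<theta>)"
  (is "_ = ?E * ?R")
proof (rule fps_eqI_deriv)
  let ?u = "Abs_fps (\<lambda>j. if Suc j \<le> m then 1 else 0) :: real fps"
  let ?v = "Abs_fps (\<lambda>j. if Suc j > m then 1 else 0) :: real fps"
  show "fps_deriv (ewens_fps \<theta> (\<lambda>j. if j \<le> m then 1 else 0)) =
      (fps_const \<theta> * ?u) * ewens_fps \<theta> (\<lambda>j. if j \<le> m then 1 else 0)"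
    by (simp add: fps_deriv_ewens_fps)
  have R: "fps_deriv ?R = fps_const \<theta> * Abs_fps (\<lambda>_. 1) * ?R"
  proof (rule fps_ext)
    fix n
    have "(fps_const \<theta> * Abs_fps (\<lambda>_. 1) * ?R) $ n = \<theta> * (\<Sum>i=0..n. rising_coeff \<theta> i)"
      unfolding mult.assoc mult.commute[of "Abs_fps _" ?R]
      by (simp only: fps_mult_left_const_nth fps_mult_nth[of ?R] fps_nth_Abs_fps mult_1_right)
    then show "fps_deriv ?R $ n = (fps_const \<theta> * Abs_fps (\<lambda>_. 1) * ?R) $ n"
      by (simp add: sum_rising_coeff)
  qed
  have u: "?u = Abs_fps (\<lambda>_. 1) - ?v"
    by (rule fps_ext) auto
  show "fps_deriv (?E * ?R) = (fps_const \<theta> * ?u) * (?E * ?R)"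
    unfolding u fps_deriv_mult R fps_deriv_fps_exp_compose_cycle_fps
    by (simp add: algebra_simps flip: fps_const_neg)
qed simp

text \<open>Each factor has only terms of degree at least m + 1, and degrees add up.\<close>

lemma cycle_fps_power_nth_eq_0:
  assumes "n < k * Suc m"
  shows "(cycle_fps (\<lambda>j. if j > m then 1 else 0) ^ k) $ n = 0"
  using assms
proof (induction k arbitrary: n)
  case (Suc k)
  let ?V = "cycle_fps (\<lambda>j. if j > m then 1 else 0)"
  have "(?V ^ Suc k) $ n = (\<Sum>i=0..n. ?V $ i * (?V ^ k) $ (n - i))"
    by (simp add: fps_mult_nth)
  also have "\<dots> = 0"
  proof (intro sum.neutral ballI)
    fix i assume "i \<in> {0..n}"
    show "?V $ i * (?V ^ k) $ (n - i) = 0"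
    proof (cases "i > m")
      case True
      then have "Suc m + k * Suc m \<le> i + k * Suc m"
        by simp
      then have "n - i < k * Suc m"
        using Suc.prems \<open>i \<in> {0..n}\<close> by (simp only: mult_Suc atLeastAtMost_iff) linarith
      then show ?thesis
        using Suc.IH by simp
    qed simp
  qed
  finally show ?case .
qed simp

text \<open>The cutoff \<open>K\<close> bounds n only relative to m, so a fixed number of terms can
  serve all n. The coefficient of the composition naturally ends at k = l instead; both ranges are
  compared with their intersection.\<close>

lemma ewens_fps_truncated_nth:
  assumes "n < Suc K * Suc m"
  shows "ewens_fps \<theta> (\<lambda>j. if j \<le> m then 1 else 0) $ n =
    (\<Sum>k\<le>K. (- \<theta>) ^ k / fact k *
      (cycle_fps (\<lambda>j. if j > m then 1 else 0) ^ k * Abs_fps (rising_coeff \<theta>)) $ n)"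
proof -
  let ?V = "cycle_fps (\<lambda>j. if j > m then 1 else 0)" and ?R = "Abs_fps (rising_coeff \<theta>)"
  have zero: "(?V ^ k) $ l = 0" if "l \<le> n" "k \<notin> {..K} \<or> k \<notin> {0..l}" for k l
  proof (rule cycle_fps_power_nth_eq_0)
    have "Suc K \<le> k \<or> l < k"
      using that(2) by auto
    then show "l < k * Suc m"
    proof
      assume "Suc K \<le> k"
      then have "Suc K * Suc m \<le> k * Suc m"
        by (rule mult_le_mono1)
      then show ?thesis
        using assms that(1) by linarith
    next
      assume "l < k"
      then show ?thesis
        using mult_le_mono2[of 1 "Suc m" k] by linarith
    qed
  qed
  have comp: "(fps_exp (- \<theta>) oo ?V) $ l = (\<Sum>k\<le>K. (- \<theta>) ^ k / fact k * (?V ^ k) $ l)" if "l \<le>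
    n" for l
  proof -
    have "(fps_exp (- \<theta>) oo ?V) $ l = (\<Sum>k\<in>{0..l}. (- \<theta>) ^ k / fact k * (?V ^ k) $ l)"
      by (simp add: fps_compose_nth)
    also have "\<dots> = (\<Sum>k\<in>{0..l} \<inter> {..K}. (- \<theta>) ^ k / fact k * (?V ^ k) $ l)"
      using zero[OF that] by (intro sum.mono_neutral_right) auto
    also have "\<dots> = (\<Sum>k\<le>K. (- \<theta>) ^ k / fact k * (?V ^ k) $ l)"
      using zero[OF that] by (intro sum.mono_neutral_left) auto
    finally show ?thesis .
  qed
  have "ewens_fps \<theta> (\<lambda>j. if j \<le> m then 1 else 0) $ n =
      (\<Sum>l=0..n. (\<Sum>k\<le>K. (- \<theta>) ^ k / fact k * (?V ^ k) $ l) * rising_coeff \<theta> (n - l))"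
    by (simp add: ewens_fps_truncated fps_mult_nth comp)
  also have "\<dots> = (\<Sum>k\<le>K. \<Sum>l=0..n. (- \<theta>) ^ k / fact k * (?V ^ k) $ l * rising_coeff \<theta> (n - l))"
    unfolding sum_distrib_right by (rule sum.swap)
  also have "\<dots> = (\<Sum>k\<le>K. (- \<theta>) ^ k / fact k * (?V ^ k * ?R) $ n)"
    by (simp add: fps_mult_nth sum_distrib_left mult.assoc)
  finally show ?thesis .
qed

subsection \<open>Lattice sums as integrals\<close>

text \<open>Each value a \<ge> 1 of the floor is taken on an interval of length 1/s, which cancels
  the factor \<open>s\<close>. The value 0 must carry weight 0, since \<open>nat\<close> sends the
  whole half-line y < 1/s to it.\<close>

lemma nn_integral_floor:
  fixes g :: "nat \<Rightarrow> real"
  assumes "s > 0" "\<And>a. 0 \<le> g a" "g 0 = 0" "\<And>a. a > n \<Longrightarrow> g a = 0"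
  shows "(\<integral>\<^sup>+ y. ennreal (s * g (nat \<lfloor>s * y\<rfloor>)) \<partial>lborel) = ennreal (\<Sum>a=0..n. g a)"
proof -
  let ?J = "\<lambda>a::nat. {real a / s..<(real a + 1) / s}"
  have ind: "indicator (?J a) y = (if nat \<lfloor>s * y\<rfloor> = a then 1 else 0 :: ennreal)" if "a \<ge> 1" for a y
  proof -
    have "y \<in> ?J a \<longleftrightarrow> real a \<le> s * y \<and> s * y < real a + 1"
      using assms(1) by (simp add: field_simps)
    also have "\<dots> \<longleftrightarrow> \<lfloor>s * y\<rfloor> = int a"
      by (simp add: floor_eq_iff)
    also have "\<dots> \<longleftrightarrow> nat \<lfloor>s * y\<rfloor> = a"
      using that by auto
    finally show ?thesis
      by (simp add: indicator_def)
  qed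
  have "ennreal (s * g (nat \<lfloor>s * y\<rfloor>)) = (\<Sum>a\<in>{1..n}. ennreal (s * g a) * indicator (?J a) y)" for y
  proof -
    have "(\<Sum>a\<in>{1..n}. ennreal (s * g a) * indicator (?J a) y) =
        (\<Sum>a\<in>{1..n}. if nat \<lfloor>s * y\<rfloor> = a then ennreal (s * g a) else 0)"
      by (intro sum.cong) (auto simp: ind)
    also have "\<dots> = (if nat \<lfloor>s * y\<rfloor> \<in> {1..n} then ennreal (s * g (nat \<lfloor>s * y\<rfloor>)) else 0)"
      by simp
    also have "\<dots> = ennreal (s * g (nat \<lfloor>s * y\<rfloor>))"
    proof -
      have "g a = 0" if "a \<notin> {1..n}" for a
        using that assms(3) assms(4)[of a] by (cases "a = 0") auto
      then show ?thesis
        by (metis ennreal_0 mult_zero_right)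
    qed
    finally show ?thesis
      by simp
  qed
  then have "(\<integral>\<^sup>+ y. ennreal (s * g (nat \<lfloor>s * y\<rfloor>)) \<partial>lborel) =
      (\<Sum>a\<in>{1..n}. \<integral>\<^sup>+ y. ennreal (s * g a) * indicator (?J a) y \<partial>lborel)"
    by (simp only:) (subst nn_integral_sum, auto)
  also have "\<dots> = (\<Sum>a\<in>{1..n}. ennreal (g a))"
  proof (intro sum.cong refl)
    fix a
    have "real a / s \<le> (real a + 1) / s"
      using assms(1) by (simp add: divide_right_mono)
    moreover have "(real a + 1) / s - real a / s = 1 / s"
      by (simp add: add_divide_distrib)
    ultimately have "emeasure lborel (?J a) = ennreal (1 / s)"
      using emeasure_lborel_Ico[of "real a / s" "(real a + 1) / s"] by (simp only:)
    then have "(\<integral>\<^sup>+ y. ennreal (s * g a) * indicator (?J a) y \<partial>lborel) =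
      ennreal (s * g a) * ennreal (1 / s)"
      by (subst nn_integral_cmult_indicator) auto
    also have "\<dots> = ennreal (s * g a * (1 / s))"
      using assms(1,2) by (intro ennreal_mult[symmetric]) auto
    also have "s * g a * (1 / s) = g a"
      using assms(1) by simp
    finally show "(\<integral>\<^sup>+ y. ennreal (s * g a) * indicator (?J a) y \<partial>lborel) = ennreal (g a)" .
  qed
  also have "\<dots> = ennreal (\<Sum>a\<in>{1..n}. g a)"
    using assms(2) by (intro sum_ennreal) auto
  also have "(\<Sum>a\<in>{1..n}. g a) = (\<Sum>a=0..n. g a)"
    using assms(3) by (simp add: sum.atLeast_Suc_atMost)
  finally show ?thesis .
qed

definition large_cycles :: "nat \<Rightarrow> real fps" where
  "large_cycles m = cycle_fps (\<lambda>j. if j > m then 1 else 0)"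

lemma large_cycles_nth: "large_cycles m $ j = (if j > m then 1 / real j else 0)"
  by (simp add: large_cycles_def)

text \<open>The guard is essential: truncated subtraction would otherwise give
  \<open>rising_coeff \<theta> 0 = 1\<close> at all lattice points with coordinate sum above
  \<open>n\<close>.\<close>

definition lattice_density :: "real \<Rightarrow> nat \<Rightarrow> real \<Rightarrow> nat \<Rightarrow> nat \<Rightarrow> (nat \<Rightarrow> real) \<Rightarrow> real" where
  "lattice_density \<theta> m s k n y = (\<Prod>i=1..k. s * large_cycles m $ nat \<lfloor>s * y i\<rfloor>) *
     (if (\<Sum>i=1..k. nat \<lfloor>s * y i\<rfloor>) \<le> n then rising_coeff \<theta> (n - (\<Sum>i=1..k. nat \<lfloor>s * y i\<rfloor>)) else 0)"

lemma measurable_sum_nat: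
  fixes f :: "'i \<Rightarrow> 'a \<Rightarrow> nat"
  assumes "\<And>i. i \<in> I \<Longrightarrow> f i \<in> M \<rightarrow>\<^sub>M count_space UNIV"
  shows "(\<lambda>x. \<Sum>i\<in>I. f i x) \<in> M \<rightarrow>\<^sub>M count_space UNIV"
  using assms
proof (induction I rule: infinite_finite_induct)
  case (insert i I)
  have "(\<lambda>x. f i x + (\<Sum>i\<in>I. f i x)) \<in> M \<rightarrow>\<^sub>M count_space UNIV"
  proof (rule measurable_compose_countable[of "\<lambda>a x. a + (\<Sum>i\<in>I. f i x)" _ _ "f i"])
    show "(\<lambda>x. a + (\<Sum>i\<in>I. f i x)) \<in> M \<rightarrow>\<^sub>M count_space UNIV" for a
      by (rule measurable_compose[OF insert.IH, of "\<lambda>b. a + b"]) (auto simp: insert.prems)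
    show "f i \<in> M \<rightarrow>\<^sub>M count_space UNIV"
      using insert.prems by simp
  qed
  with insert show ?case
    by simp
qed auto

lemma borel_measurable_lattice_density [measurable]:
  "lattice_density \<theta> m s k n \<in> borel_measurable (Pi\<^sub>M {1..k} (\<lambda>_. lborel))"
proof -
  have a: "(\<lambda>y. nat \<lfloor>s * y i\<rfloor>) \<in> Pi\<^sub>M {1..k} (\<lambda>_. lborel) \<rightarrow>\<^sub>M count_space UNIV" if "i \<in> {1..k}" for i
  proof -
    have "(\<lambda>y. y i) \<in> borel_measurable (Pi\<^sub>M {1..k} (\<lambda>_. lborel))"
      using measurable_component_singleton[OF that, of "\<lambda>_. lborel"] by simp
    then show ?thesis
      by measurable
  qed
  have "(\<lambda>y. \<Prod>i=1..k. s * large_cycles m $ nat \<lfloor>s *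
    y i\<rfloor>) \<in> borel_measurable (Pi\<^sub>M {1..k} (\<lambda>_. lborel))"
    using a by (intro borel_measurable_prod measurable_compose[OF a]) auto
  moreover have "(\<lambda>y. (\<lambda>j. if j \<le> n then rising_coeff \<theta> (n - j) else 0) (\<Sum>i=1..k. nat \<lfloor>s * y i\<rfloor>))
      \<in> borel_measurable (Pi\<^sub>M {1..k} (\<lambda>_. lborel))"
    by (rule measurable_compose[OF measurable_sum_nat[OF a]]) auto
  ultimately show ?thesis
    unfolding lattice_density_def[abs_def] by (intro borel_measurable_times) auto
qed

lemma lattice_density_nonneg:
  assumes "\<theta> > 0" "s > 0"
  shows "0 \<le> lattice_density \<theta> m s k n y"
  unfolding lattice_density_def
  using assms rising_coeff_pos[of \<theta>]
    by (auto intro!: mult_nonneg_nonneg prod_nonneg simp: large_cycles_nth less_imp_le)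

lemma large_cycles_power_nth_nonneg:
  assumes "\<theta> > 0"
  shows "0 \<le> (large_cycles m ^ k * Abs_fps (rising_coeff \<theta>)) $ n"
proof (induction k arbitrary: n)
  case (Suc k)
  have "(large_cycles m ^ Suc k * Abs_fps (rising_coeff \<theta>)) $ n =
      (\<Sum>a=0..n. large_cycles m $ a * (large_cycles m ^ k * Abs_fps (rising_coeff \<theta>)) $ (n - a))"
    unfolding power_Suc mult.assoc by (rule fps_mult_nth)
  with Suc show ?case
    by (auto intro!: sum_nonneg mult_nonneg_nonneg simp: large_cycles_nth)
qed (use rising_coeff_pos[OF assms] in \<open>simp add: less_imp_le\<close>)

text \<open>Splits off the last coordinate in the way in which one more factor
  \<open>large_cycles m\<close> splits a coefficient; iterated integration thereby matches the
  Cauchy product.\<close>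

lemma lattice_density_insert:
  "lattice_density \<theta> m s (Suc k) n (x(Suc k := y)) =
    s * large_cycles m $ nat \<lfloor>s * y\<rfloor> *
    (if nat \<lfloor>s * y\<rfloor> \<le> n then lattice_density \<theta> m s k (n - nat \<lfloor>s * y\<rfloor>) x else 0)"
proof -
  have "(\<Sum>i=1..k. nat \<lfloor>s * (x(Suc k := y)) i\<rfloor>) = (\<Sum>i=1..k. nat \<lfloor>s * x i\<rfloor>)"
    by (intro sum.cong) auto
  moreover have "(\<Prod>i=1..k. s * large_cycles m $ nat \<lfloor>s * (x(Suc k := y)) i\<rfloor>) =
    (\<Prod>i=1..k. s * large_cycles m $ nat \<lfloor>s * x i\<rfloor>)"
    by (intro prod.cong) auto
  ultimately show ?thesis
    by (auto simp: lattice_density_def prod.cl_ivl_Suc sum.cl_ivl_Suc algebra_simps)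
qed

text \<open>
  The coefficient on the right is a sum over lattice points, and \<^term>\<open>lattice_density\<close> is
  the corresponding step function on cubes of side \<^term>\<open>1 / s\<close>.
\<close>

lemma nn_integral_lattice_density:
  assumes "\<theta> > 0" "s > 0"
  shows "(\<integral>\<^sup>+ y. ennreal (lattice_density \<theta> m s k n y) \<partial>Pi\<^sub>M {1..k} (\<lambda>_. lborel)) =
    ennreal ((large_cycles m ^ k * Abs_fps (rising_coeff \<theta>)) $ n)"
proof (induction k arbitrary: n)
  case 0
  interpret product_sigma_finite "\<lambda>_::nat. lborel :: real measure"
    by standard
  show ?case
    by (simp add: lattice_density_def space_PiM)
next
  case (Suc k)
  interpret product_sigma_finite "\<lambda>_::nat. lborel :: real measure"
    by standard
  let ?W = "\<lambda>k n. (large_cycles m ^ k * Abs_fps (rising_coeff \<theta>)) $ n"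
  define g where "g = (\<lambda>a. large_cycles m $ a * (if a \<le> n then ?W k (n - a) else 0))"
  have eq: "{1..Suc k} = insert (Suc k) {1..k}"
    by auto
  have "(\<integral>\<^sup>+ y. ennreal (lattice_density \<theta> m s (Suc k) n y) \<partial>Pi\<^sub>M {1..Suc k} (\<lambda>_. lborel)) =
      (\<integral>\<^sup>+ y. \<integral>\<^sup>+ x. ennreal (lattice_density \<theta> m s (Suc k) n (x(Suc k := y))) \<partial>Pi\<^sub>M {1..k} (\<lambda>_. lborel) \<partial>lborel)"
  proof -
    have "(\<lambda>y. ennreal (lattice_density \<theta> m s (Suc k) n y)) \<in> borel_measurable (Pi\<^sub>M {1..Suc k} (\<lambda>_. lborel))"
      by measurable
    then show ?thesis
      unfolding eq by (intro product_nn_integral_insert_rev) auto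
  qed
  also have "\<dots> = (\<integral>\<^sup>+ y. ennreal (s * g (nat \<lfloor>s * y\<rfloor>)) \<partial>lborel)"
  proof (intro nn_integral_cong)
    fix y :: real
    let ?a = "nat \<lfloor>s * y\<rfloor>"
    \<comment> \<open>Gathers all that depends on the last coordinate alone, including the guard, so
      that it can be pulled out of the inner integral.\<close>
    define c where "c = s * large_cycles m $ ?a * (if ?a \<le> n then 1 else 0)"
    have c: "c \<ge> 0"
      using assms by (simp add: c_def large_cycles_nth)
    have "lattice_density \<theta> m s (Suc k) n (x(Suc k := y)) =
      c * lattice_density \<theta> m s k (n - ?a) x" for x
      by (simp add: c_def lattice_density_insert)
    then have "(\<integral>\<^sup>+ x. ennreal (lattice_density \<theta> m s (Suc k) n (x(Suc k := y))) \<partial>Pi\<^sub>M {1..k} (\<lambda>_. lborel)) =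
        (\<integral>\<^sup>+ x. ennreal c * ennreal (lattice_density \<theta> m s k (n - ?a) x) \<partial>Pi\<^sub>M {1..k} (\<lambda>_. lborel))"
      using c lattice_density_nonneg[OF assms] by (simp add: ennreal_mult)
    also have "\<dots> = ennreal c * (\<integral>\<^sup>+ x. ennreal (lattice_density \<theta> m s k (n - ?a) x) \<partial>Pi\<^sub>M {1..k} (\<lambda>_. lborel))"
      by (intro nn_integral_cmult) measurable
    also have "\<dots> = ennreal (c * ?W k (n - ?a))"
      using c large_cycles_power_nth_nonneg[OF assms(1)] by (simp only: Suc.IH ennreal_mult)
    also have "c * ?W k (n - ?a) = s * g ?a"
      by (simp add: g_def c_def)
    finally show "(\<integral>\<^sup>+ x. ennreal (lattice_density \<theta> m s (Suc k) n (x(Suc k := y))) \<partial>Pi\<^sub>M {1..k} (\<lambda>_. lborel)) =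
        ennreal (s * g ?a)" .
  qed
  also have "\<dots> = ennreal (\<Sum>a=0..n. g a)"
    using assms large_cycles_power_nth_nonneg[OF assms(1)]
    by (intro nn_integral_floor) (auto simp: g_def large_cycles_nth)
  also have "(\<Sum>a=0..n. g a) = ?W (Suc k) n"
    unfolding power_Suc mult.assoc fps_mult_nth[of "large_cycles m"]
      by (intro sum.cong) (auto simp: g_def)
  finally show ?case .
qed

lemma integral_lattice_density:
  assumes "\<theta> > 0" "s > 0"
  shows "(LINT y|Pi\<^sub>M {1..k} (\<lambda>_. lborel). lattice_density \<theta> m s k n y) =
    (large_cycles m ^ k * Abs_fps (rising_coeff \<theta>)) $ n"
proof -
  have "(LINT y|Pi\<^sub>M {1..k} (\<lambda>_. lborel). lattice_density \<theta> m s k n y) =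
      enn2real (\<integral>\<^sup>+ y. ennreal (lattice_density \<theta> m s k n y) \<partial>Pi\<^sub>M {1..k} (\<lambda>_. lborel))"
    by (rule integral_eq_nn_integral) (use lattice_density_nonneg[OF assms] in \<open>auto simp del: One_nat_def\<close>)
  then show ?thesis
    using large_cycles_power_nth_nonneg[OF assms(1)]
      by (simp only: nn_integral_lattice_density[OF assms] enn2real_ennreal)
qed

text \<open>Rests on \<open>Gamma_series \<theta> n\<close>, which tends to Gamma(\<theta>):
  \<open>rising_coeff \<theta> n\<close> is n^\<theta> / (\<theta> + n) divided by it. The base n +
  1 keeps the quotient positive at n = 0, where \<open>0 powr _\<close> would be 0.\<close>

lemma rising_coeff_asymptotics:
  assumes "\<theta> > 0"
  shows "(\<lambda>n. rising_coeff \<theta> n / (real n + 1) powr (\<theta> - 1)) \<longlonglongrightarrow> 1 / Gamma \<theta>"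
proof -
  have lim: "(\<lambda>n. inverse (Gamma_series \<theta> n) * (real n powr \<theta> / ((\<theta> + real n) * (real n +
    1) powr (\<theta> - 1))))
      \<longlonglongrightarrow> inverse (Gamma \<theta>) * 1"
  proof (intro tendsto_mult tendsto_inverse Gamma_series_LIMSEQ)
    show "(\<lambda>n. real n powr \<theta> / ((\<theta> + real n) * (real n + 1) powr (\<theta> - 1))) \<longlonglongrightarrow> 1"
      using assms by real_asymp
    show "Gamma \<theta> \<noteq> 0"
      using Gamma_real_pos[OF assms] by simp
  qed
  have "eventually (\<lambda>n. inverse (Gamma_series \<theta> n) * (real n powr \<theta> / ((\<theta> + real n) * (real n +
    1) powr (\<theta> - 1)))
      = rising_coeff \<theta> n / (real n + 1) powr (\<theta> - 1)) sequentially"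
    using eventually_gt_at_top[of 0]
  proof eventually_elim
    case (elim n)
    have cancel: "inverse (f * a / (p * t)) * (a / (t * q)) = p / f / q"
      if "f \<noteq> 0" "a \<noteq> 0" "t \<noteq> 0" for f a p t q :: real
      using that by (simp add: field_simps)
    have "Gamma_series \<theta> n = fact n * real n powr \<theta> / (pochhammer \<theta> n * (\<theta> + real n))"
      using elim by (simp add: Gamma_series_def pochhammer_Suc powr_def)
    then show ?case
      unfolding rising_coeff_def using elim assms by (simp only:) (rule cancel, auto)
  qed
  from Lim_transform_eventually[OF lim this] show ?thesis
    by (simp add: field_simps)
qed

text \<open>The normalised sequence \<rho> is positive and tends to a nonzero limit, so it and its
  reciprocal are bounded; the product of the two bounds serves all indices, small ones
  included.\<close>

lemma rising_coeff_bounds: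
  assumes "\<theta> > 0"
  obtains C where "C > 0" and "\<And>n M. rising_coeff \<theta> M / rising_coeff \<theta> n \<le>
    C * ((real M + 1) / (real n + 1)) powr (\<theta> - 1)"
proof -
  define \<rho> where "\<rho> n = rising_coeff \<theta> n / (real n + 1) powr (\<theta> - 1)" for n
  have pos: "\<rho> n > 0" for n
    using rising_coeff_pos[OF assms] by (simp add: \<rho>_def)
  have lim: "\<rho> \<longlonglongrightarrow> 1 / Gamma \<theta>"
    unfolding \<rho>_def by (rule rising_coeff_asymptotics[OF assms])
  have "Gamma \<theta> > 0"
    using assms by (rule Gamma_real_pos)
  then have "Bseq \<rho>" "Bseq (\<lambda>n. inverse (\<rho> n))"
    using lim tendsto_inverse[OF lim] by (auto intro: convergentI convergent_imp_Bseq)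
  then obtain A B where A: "A > 0" "\<And>n. norm (\<rho> n) \<le> A" and B: "B > 0" "\<And>n. norm (inverse (\<rho> n)) \<le>
    B"
    by (auto elim!: BseqE)
  show ?thesis
  proof (rule that[of "A * B"])
    fix n M
    have "rising_coeff \<theta> M / rising_coeff \<theta> n =
      \<rho> M * inverse (\<rho> n) * ((real M + 1) / (real n + 1)) powr (\<theta> - 1)"
      using rising_coeff_pos[OF assms, of n] by (simp add: \<rho>_def powr_divide field_simps)
    also have "\<dots> \<le> A * B * ((real M + 1) / (real n + 1)) powr (\<theta> - 1)"
      using A(2)[of M] B(2)[of n] pos[of M] pos[of n] A(1) B(1)
        by (intro mult_right_mono mult_mono) auto
    finally show "rising_coeff \<theta> M / rising_coeff \<theta> n \<le>
      A * B * ((real M + 1) / (real n + 1)) powr (\<theta> - 1)" .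
  qed (use A B in simp)
qed

subsection \<open>The limit density\<close>

text \<open>Unnormalised Dirichlet density with parameters 1, ..., 1, \<theta>. It supplies the
  majorants; for \<open>\<theta> = 1\<close> it is the indicator of the open simplex.\<close>

definition simplex_density :: "real \<Rightarrow> nat \<Rightarrow> (nat \<Rightarrow> real) \<Rightarrow> real" where
  "simplex_density \<theta> k y =
    (if (\<forall>i\<in>{1..k}. 0 < y i) \<and> (\<Sum>i=1..k. y i) < 1 then (1 - (\<Sum>i=1..k. y i)) powr (\<theta> - 1) else 0)"

definition limit_density :: "real \<Rightarrow> real \<Rightarrow> nat \<Rightarrow> (nat \<Rightarrow> real) \<Rightarrow> real" where
  "limit_density \<theta> x k y =
    (if (\<forall>i\<in>{1..k}. x < y i) \<and> (\<Sum>i=1..k. y i) < 1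
     then (1 - (\<Sum>i=1..k. y i)) powr (\<theta> - 1) / (\<Prod>i=1..k. y i) else 0)"

lemma borel_measurable_component:
  "i \<in> {1..k} \<Longrightarrow> (\<lambda>y. y i) \<in> borel_measurable (Pi\<^sub>M {1..k} (\<lambda>_. lborel :: real measure))"
  for k :: nat
  using measurable_component_singleton[of i "{1..k}" "\<lambda>_. lborel :: real measure"] by simp

lemma measurable_simplex:
  "Measurable.pred (Pi\<^sub>M {1..k} (\<lambda>_. lborel)) (\<lambda>y. (\<forall>i\<in>{1..k}. x < y i) \<and> (\<Sum>i=1..k. y i) <
    (1::real))"
  for k :: nat
proof (intro pred_intros_logic pred_intros_finite)
  show "Measurable.pred (Pi\<^sub>M {1..k} (\<lambda>_. lborel)) (\<lambda>y. x < y i)" if "i \<in> {1..k}" for i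
    using borel_measurable_component[OF that] by measurable
  have "(\<lambda>y. \<Sum>i=1..k. y i) \<in> borel_measurable (Pi\<^sub>M {1..k} (\<lambda>_. lborel :: real measure))"
    by (intro borel_measurable_sum borel_measurable_component)
  then show "Measurable.pred (Pi\<^sub>M {1..k} (\<lambda>_. lborel)) (\<lambda>y. (\<Sum>i=1..k. y i) < (1::real))"
    by measurable
qed simp

lemma borel_measurable_simplex_density [measurable]:
  "simplex_density \<theta> k \<in> borel_measurable (Pi\<^sub>M {1..k} (\<lambda>_. lborel))"
  unfolding simplex_density_def[abs_def]
  by (intro measurable_If measurable_simplex[unfolded pred_def] powr_real_measurable borel_measurable_diff
      borel_measurable_sum borel_measurable_component borel_measurable_const) auto

lemma borel_measurable_limit_density [measurable]:
  "limit_density \<theta> x k \<in> borel_measurable (Pi\<^sub>M {1..k} (\<lambda>_. lborel))"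
  unfolding limit_density_def[abs_def]
  by (intro measurable_If measurable_simplex[unfolded pred_def] borel_measurable_divide powr_real_measurable borel_measurable_diff
      borel_measurable_sum borel_measurable_prod borel_measurable_component borel_measurable_const) auto

text \<open>Reflecting t to a - t moves the possible singularity to 0, where the exponent \<theta> -
  1 > -1 is integrable.\<close>

lemma nn_integral_powr_from_0:
  assumes "\<theta> > 0" "a \<ge> 0"
  shows "(\<integral>\<^sup>+ t. ennreal (if 0 < t \<and> t < a then (a - t) powr (\<theta> - 1) else 0) \<partial>lborel) \<le>
    ennreal (a powr \<theta> / \<theta>)"
proof -
  have I: "((\<lambda>t. t powr (\<theta> - 1)) has_integral (a powr \<theta> / \<theta>)) {0..a}"
    using has_integral_powr_from_0[of "\<theta> - 1" a] assms by simp
  have "(\<integral>\<^sup>+ t. ennreal (if 0 < t \<and> t < a then (a - t) powr (\<theta> - 1) else 0) \<partial>lborel) =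
      (\<integral>\<^sup>+ t. ennreal (if 0 < t \<and> t < a then t powr (\<theta> - 1) else 0) \<partial>lborel)"
    by (subst nn_integral_real_affine[where c = "-1" and t = a]) (auto intro!: nn_integral_cong)
  also have "\<dots> \<le> (\<integral>\<^sup>+ t. ennreal (indicator {0..a} t * t powr (\<theta> - 1)) \<partial>lborel)"
    by (intro nn_integral_mono) (auto simp: indicator_def)
  also have "\<dots> = ennreal (a powr \<theta> / \<theta>)"
    by (rule nn_integral_has_integral_lebesgue[OF _ I]) simp
  finally show ?thesis .
qed

text \<open>Integrating the last coordinate first leaves at most a^\<theta> / \<theta>, where a
  \<le> 1 is what the other coordinates leave of the total 1, and those range over the unit cube of
  volume 1. This crude bound is enough for integrability.\<close>

lemma nn_integral_simplex_density:
  assumes "\<theta> > 0"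
  shows "(\<integral>\<^sup>+ y. ennreal (simplex_density \<theta> (Suc k) y) \<partial>Pi\<^sub>M {1..Suc k} (\<lambda>_. lborel)) \<le>
    ennreal (1 / \<theta>)"
proof -
  interpret product_sigma_finite "\<lambda>_::nat. lborel :: real measure"
    by standard
  let ?B = "\<Pi>\<^sub>E i\<in>{1..k}. {0<..<1::real}"
  have eq: "{1..Suc k} = insert (Suc k) {1..k}"
    by auto
  have "(\<lambda>y. ennreal (simplex_density \<theta> (Suc k) y)) \<in> borel_measurable (Pi\<^sub>M {1..Suc k} (\<lambda>_. lborel))"
    by measurable
  then have "(\<integral>\<^sup>+ y. ennreal (simplex_density \<theta> (Suc k) y) \<partial>Pi\<^sub>M {1..Suc k} (\<lambda>_. lborel)) =
      (\<integral>\<^sup>+ x. \<integral>\<^sup>+ t. ennreal (simplex_density \<theta> (Suc k) (x(Suc k := t))) \<partial>lborel \<partial>Pi\<^sub>M {1..k} (\<lambda>_. lborel))"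
    unfolding eq by (intro product_nn_integral_insert) auto
  also have "\<dots> \<le> (\<integral>\<^sup>+ x. ennreal (1 / \<theta>) * indicator ?B x \<partial>Pi\<^sub>M {1..k} (\<lambda>_. lborel))"
  proof (rule nn_integral_mono)
    fix x :: "nat \<Rightarrow> real"
    assume x: "x \<in> space (Pi\<^sub>M {1..k} (\<lambda>_. lborel))"
    define a where "a = 1 - (\<Sum>i=1..k. x i)"
    have dens: "simplex_density \<theta> (Suc k) (x(Suc k := t)) =
        (if (\<forall>i\<in>{1..k}. 0 < x i) \<and> 0 < t \<and> t < a then (a - t) powr (\<theta> - 1) else 0)" for t
    proof -
      have "(\<Sum>i=1..Suc k. (x(Suc k := t)) i) = 1 - a + t"
        by (simp add: a_def sum.cl_ivl_Suc)
      moreover have "(\<forall>i\<in>{1..Suc k}. 0 < (x(Suc k := t)) i) \<longleftrightarrow> (\<forall>i\<in>{1..k}. 0 < x i) \<and> 0 < t"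
        unfolding eq by auto
      ultimately show ?thesis
        by (simp only: simplex_density_def) (simp add: algebra_simps)
    qed
    show "(\<integral>\<^sup>+ t. ennreal (simplex_density \<theta> (Suc k) (x(Suc k := t))) \<partial>lborel) \<le>
      ennreal (1 / \<theta>) * indicator ?B x"
    proof (cases "(\<forall>i\<in>{1..k}. 0 < x i) \<and> 0 < a")
      case True
      have "x i \<le> (\<Sum>i=1..k. x i)" if "i \<in> {1..k}" for i
        using True that by (intro member_le_sum) (auto intro: less_imp_le)
      then have "x i < 1" if "i \<in> {1..k}" for i
        using True that by (force simp: a_def)
      then have B: "x \<in> ?B"
        using True x by (auto simp: space_PiM PiE_iff)
      have "0 \<le> (\<Sum>i=1..k. x i)"
        using True by (intro sum_nonneg) (auto intro: less_imp_le)
      then have "a powr \<theta> \<le> 1"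
        using True assms by (intro powr_le1) (auto simp: a_def)
      have "(\<integral>\<^sup>+ t. ennreal (simplex_density \<theta> (Suc k) (x(Suc k := t))) \<partial>lborel) \<le>
        ennreal (a powr \<theta> / \<theta>)"
        using nn_integral_powr_from_0[OF assms, of a] True by (simp add: dens)
      also have "\<dots> \<le> ennreal (1 / \<theta>)"
        using \<open>a powr \<theta> \<le> 1\<close> assms by (intro ennreal_leI divide_right_mono) auto
      finally show ?thesis
        using B by simp
    next
      case False
      then have "simplex_density \<theta> (Suc k) (x(Suc k := t)) = 0" for t
        by (auto simp: dens)
      then show ?thesis
        by simp
    qed
  qed
  also have "\<dots> = ennreal (1 / \<theta>) * emeasure (Pi\<^sub>M {1..k} (\<lambda>_. lborel)) ?B"
    by (rule nn_integral_cmult_indicator) (auto intro!: sets_PiM_I_finite)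
  also have "emeasure (Pi\<^sub>M {1..k} (\<lambda>_. lborel)) ?B = 1"
    by (subst emeasure_PiM) auto
  finally show ?thesis
    by simp
qed

lemma simplex_density_nonneg: "0 \<le> simplex_density \<theta> k y"
  by (simp add: simplex_density_def)

lemma integrable_simplex_density:
  assumes "\<theta> > 0" "k \<ge> 1"
  shows "integrable (Pi\<^sub>M {1..k} (\<lambda>_. lborel)) (simplex_density \<theta> k)"
proof (rule integrableI_nonneg)
  obtain l where l: "k = Suc l"
    using assms(2) by (cases k) auto
  show "(\<integral>\<^sup>+ y. ennreal (simplex_density \<theta> k y) \<partial>Pi\<^sub>M {1..k} (\<lambda>_. lborel)) < \<infinity>"
    using nn_integral_simplex_density[OF assms(1), of l] unfolding l
    by (rule le_less_trans) (simp add: ennreal_less_top)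
qed (auto simp: simplex_density_nonneg simp del: One_nat_def)

lemma limit_density_nonneg:
  assumes "x > 0"
  shows "0 \<le> limit_density \<theta> x k y"
proof (cases "\<forall>i\<in>{1..k}. x < y i")
  case True
  then have "0 \<le> (\<Prod>i=1..k. y i)"
    using assms by (intro prod_nonneg) (meson less_imp_le less_trans)
  then show ?thesis
    by (auto simp: limit_density_def)
qed (auto simp: limit_density_def simp del: One_nat_def)

lemma limit_density_le:
  assumes "x > 0"
  shows "limit_density \<theta> x k y \<le> (1 / x) ^ k * simplex_density \<theta> k y"
proof (cases "(\<forall>i\<in>{1..k}. x < y i) \<and> (\<Sum>i=1..k. y i) < 1")
  case True
  have "(\<Prod>i=1..k. 1 / y i) \<le> (\<Prod>i=1..k. 1 / x)"
  proof (rule prod_mono)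
    fix i assume "i \<in> {1..k}"
    then have "x < y i"
      using True by auto
    then show "0 \<le> 1 / y i \<and> 1 / y i \<le> 1 / x"
      using assms by (simp add: field_simps)
  qed
  then have "1 / (\<Prod>i=1..k. y i) \<le> (1 / x) ^ k"
    by (simp add: prod_dividef)
  from mult_right_mono[OF this, of "(1 - (\<Sum>i=1..k. y i)) powr (\<theta> - 1)"] True assms show ?thesis
    by (force simp: limit_density_def simplex_density_def simp del: One_nat_def)
next
  case False
  then have "limit_density \<theta> x k y = 0"
    by (auto simp: limit_density_def)
  then show ?thesis
    using assms simplex_density_nonneg[of \<theta> k y] by simp
qed

lemma integrable_limit_density:
  assumes "\<theta> > 0" "k \<ge> 1" "x > 0"
  shows "integrable (Pi\<^sub>M {1..k} (\<lambda>_. lborel)) (limit_density \<theta> x k)"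
proof (rule Bochner_Integration.integrable_bound)
  show "integrable (Pi\<^sub>M {1..k} (\<lambda>_. lborel)) (\<lambda>y. (1 / x) ^ k * simplex_density \<theta> k y)"
    by (intro integrable_mult_right integrable_simplex_density assms)
  show "AE y in Pi\<^sub>M {1..k} (\<lambda>_. lborel). norm (limit_density \<theta> x k y) \<le>
    norm ((1 / x) ^ k * simplex_density \<theta> k y)"
    using limit_density_nonneg[OF assms(3)] limit_density_le[OF assms(3)] assms(3)
    by (intro AE_I2) (auto simp: simplex_density_nonneg abs_mult)
qed measurable

lemma LINT_simplex_region:
  assumes "x > 0"
  shows "(LINT y:simplex_region k (1 / x)|Pi\<^sub>M {1..k} (\<lambda>_. lborel).
      (1 - (\<Sum>j=1..k. y j)) powr (\<theta> - 1) / (\<Prod>j=1..k. y j)) =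
    (LINT y|Pi\<^sub>M {1..k} (\<lambda>_. lborel). limit_density \<theta> x k y)"
  unfolding set_lebesgue_integral_def
proof (rule Bochner_Integration.integral_cong)
  fix y :: "nat \<Rightarrow> real"
  assume "y \<in> space (Pi\<^sub>M {1..k} (\<lambda>_. lborel))"
  then have "y \<in> {1..k} \<rightarrow>\<^sub>E UNIV"
    by (simp add: space_PiM)
  then show "indicator (simplex_region k (1 / x)) y *\<^sub>R ((1 - (\<Sum>j=1..k. y j)) powr (\<theta> - 1) /
    (\<Prod>j=1..k. y j)) =
      limit_density \<theta> x k y"
    by (simp add: simplex_region_def limit_density_def indicator_def del: One_nat_def)
qed simp

lemma limit_density_eq_0:
  assumes "x > 0" "k \<ge> 1" "real k * x \<ge> 1"
  shows "limit_density \<theta> x k y = 0"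
proof -
  have "1 \<le> (\<Sum>i=1..k. y i)" if "\<forall>i\<in>{1..k}. x < y i"
  proof -
    have "(\<Sum>i=1..k. x) \<le> (\<Sum>i=1..k. y i)"
      using that by (intro sum_mono) (auto intro: less_imp_le)
    then show ?thesis
      using assms by simp
  qed
  then show ?thesis
    by (auto simp: limit_density_def simp del: One_nat_def)
qed

text \<open>The limit density jumps where a coordinate equals \<open>x\<close>, and the step
  functions need not converge there; these hyperplanes have to be discarded as null sets.\<close>

lemma AE_component_neq:
  "AE y in Pi\<^sub>M {1..k} (\<lambda>_. lborel). \<forall>i\<in>{1..k}. y i \<noteq> (x::real)"
  for k :: nat
proof (rule AE_finite_allI)
  fix i assume i: "i \<in> {1..k}"
  interpret product_sigma_finite "\<lambda>_::nat. lborel :: real measure"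
    by standard
  let ?N = "\<Pi>\<^sub>E j\<in>{1..k}. if j = i then {x} else UNIV"
  have "emeasure (Pi\<^sub>M {1..k} (\<lambda>_. lborel)) ?N = (\<Prod>j\<in>{1..k}. emeasure lborel (if j =
    i then {x} else UNIV))"
    using emeasure_PiM[of "{1..k}" "\<lambda>j. if j = i then {x} else UNIV"] by auto
  \<comment> \<open>The factor for \<open>i\<close> is 0 and annihilates the infinite factors of the
    other coordinates.\<close>
  also have "\<dots> = 0"
    using i by (auto intro!: prod_zero bexI[of _ i])
  finally have "?N \<in> null_sets (Pi\<^sub>M {1..k} (\<lambda>_. lborel))"
    by (intro null_setsI sets_PiM_I_finite) auto
  moreover have "{y \<in> space (Pi\<^sub>M {1..k} (\<lambda>_. lborel)). \<not> y i \<noteq> x} \<subseteq> ?N"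
    by (auto simp: space_PiM PiE_iff extensional_def)
  ultimately show "AE y in Pi\<^sub>M {1..k} (\<lambda>_. lborel). y i \<noteq> x"
    by (rule AE_I')
qed simp

subsection \<open>Convergence of the lattice sums\<close>

lemma floor_quotient_tendsto:
  fixes t :: real
  assumes "t \<ge> 0"
  shows "(\<lambda>n. real (nat \<lfloor>(real n + real k) * t\<rfloor>) / (real n + 1)) \<longlonglongrightarrow> t"
proof (rule tendsto_sandwich)
  have *: "(real n + real k) * t - 1 \<le> real (nat \<lfloor>(real n + real k) * t\<rfloor>)"
    "real (nat \<lfloor>(real n + real k) * t\<rfloor>) \<le> (real n + real k) * t" for n
  proof -
    have "0 \<le> (real n + real k) * t"
      using assms by simp
    then show "(real n + real k) * t - 1 \<le> real (nat \<lfloor>(real n + real k) * t\<rfloor>)"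
      "real (nat \<lfloor>(real n + real k) * t\<rfloor>) \<le> (real n + real k) * t"
      by linarith+
  qed
  show "eventually (\<lambda>n. ((real n + real k) * t - 1) / (real n + 1) \<le>
    real (nat \<lfloor>(real n + real k) * t\<rfloor>) / (real n + 1)) sequentially"
    using * by (intro always_eventually allI divide_right_mono) auto
  show "eventually (\<lambda>n. real (nat \<lfloor>(real n + real k) * t\<rfloor>) / (real n + 1) \<le>
    (real n + real k) * t / (real n + 1)) sequentially"
    using * by (intro always_eventually allI divide_right_mono) auto
  have "(\<lambda>n. (real n + real k) / (real n + 1)) \<longlonglongrightarrow> 1"
    by real_asymp
  then have 1: "(\<lambda>n. (real n + real k) / (real n + 1) * t) \<longlonglongrightarrow> 1 * t"
    by (rule tendsto_mult_right)
  have 2: "(\<lambda>n. 1 / (real n + 1)) \<longlonglongrightarrow> 0"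
    by real_asymp
  show "(\<lambda>n. ((real n + real k) * t - 1) / (real n + 1)) \<longlonglongrightarrow> t"
    "(\<lambda>n. (real n + real k) * t / (real n + 1)) \<longlonglongrightarrow> t"
    using 1 tendsto_diff[OF 1 2] by (simp_all add: diff_divide_distrib)
qed

text \<open>The ratio is \<rho>(M n) / \<rho>(n) times ((M n + 1) / (n + 1))^(\<theta> - 1). Since c
  > 0 forces \<open>M n\<close> to infinity, both values of \<rho> share a nonzero limit and their
  quotient tends to 1.\<close>

lemma rising_coeff_quotient_tendsto:
  assumes "\<theta> > 0" "c > 0" "(\<lambda>n. (real (M n) + 1) / (real n + 1)) \<longlonglongrightarrow> c"
  shows "(\<lambda>n. rising_coeff \<theta> (M n) / rising_coeff \<theta> n) \<longlonglongrightarrow> c powr (\<theta> - 1)"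
proof -
  define \<rho> where "\<rho> n = rising_coeff \<theta> n / (real n + 1) powr (\<theta> - 1)" for n
  have lim: "\<rho> \<longlonglongrightarrow> 1 / Gamma \<theta>"
    unfolding \<rho>_def by (rule rising_coeff_asymptotics[OF assms(1)])
  have "filterlim (\<lambda>n. (real (M n) + 1) / (real n + 1) * (real n + 1)) at_top sequentially"
    by (rule filterlim_tendsto_pos_mult_at_top[OF assms(3,2)]) real_asymp
  then have "filterlim (\<lambda>n. real (M n) + 1) at_top sequentially"
    by (simp add: add_pos_nonneg)
  then have "filterlim (\<lambda>n. (-1) + (real (M n) + 1)) at_top sequentially"
    by (rule filterlim_tendsto_add_at_top[OF tendsto_const])
  then have "filterlim M at_top sequentially"
    by (simp add: filterlim_sequentially_iff_filterlim_real)
  then have "(\<lambda>n. \<rho> (M n)) \<longlonglongrightarrow> 1 / Gamma \<theta>"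
    by (rule filterlim_compose[OF lim])
  moreover have "Gamma \<theta> > 0"
    using assms(1) by (rule Gamma_real_pos)
  moreover from this have "1 / Gamma \<theta> \<noteq> 0"
    by simp
  ultimately have "(\<lambda>n. \<rho> (M n) / \<rho> n * ((real (M n) + 1) / (real n + 1)) powr (\<theta> - 1))
      \<longlonglongrightarrow> (1 / Gamma \<theta>) / (1 / Gamma \<theta>) * c powr (\<theta> - 1)"
    using assms(2) by (intro tendsto_mult tendsto_divide lim tendsto_powr[OF assms(3) tendsto_const]) simp_all
  moreover have "\<rho> (M n) / \<rho> n * ((real (M n) + 1) / (real n + 1)) powr (\<theta> - 1) =
      rising_coeff \<theta> (M n) / rising_coeff \<theta> n" for n
    using rising_coeff_pos[OF assms(1), of n] by (simp add: \<rho>_def powr_divide field_simps)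
  ultimately show ?thesis
    using \<open>Gamma \<theta> > 0\<close> by simp
qed

lemma lattice_density_eq_0:
  assumes "i \<in> {1..k}" "nat \<lfloor>s * y i\<rfloor> \<le> m"
  shows "lattice_density \<theta> m s k n y = 0"
proof -
  have "(\<Prod>i=1..k. s * large_cycles m $ nat \<lfloor>s * y i\<rfloor>) = 0"
    using assms by (intro prod_zero bexI[of _ i]) (auto simp: large_cycles_nth)
  then show ?thesis
    by (simp add: lattice_density_def)
qed

lemma lattice_density_eq:
  assumes "\<forall>i\<in>{1..k}. m < nat \<lfloor>s * y i\<rfloor>" "(\<Sum>i=1..k. nat \<lfloor>s * y i\<rfloor>) \<le> n"
  shows "lattice_density \<theta> m s k n y =
    (\<Prod>i=1..k. s / real (nat \<lfloor>s * y i\<rfloor>)) * rising_coeff \<theta> (n - (\<Sum>i=1..k. nat \<lfloor>s * y i\<rfloor>))"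
proof -
  have "(\<Prod>i=1..k. s * large_cycles m $ nat \<lfloor>s * y i\<rfloor>) = (\<Prod>i=1..k. s / real (nat \<lfloor>s * y i\<rfloor>))"
    using assms(1) by (intro prod.cong) (auto simp: large_cycles_nth)
  with assms(2) show ?thesis
    by (simp add: lattice_density_def)
qed

text \<open>
  With the lattice scaled by \<^term>\<open>n + k\<close> instead of \<^term>\<open>n\<close>, every cube that meets the
  support of the step function lies inside the open simplex.
\<close>

lemma sum_less_1_if_floor_sum_le:
  assumes "k \<ge> 1" "(\<Sum>i=1..k. nat \<lfloor>(real n + real k) * y i\<rfloor>) \<le> n"
  shows "(\<Sum>i=1..k. y i) < (1::real)"
proof -
  let ?s = "real n + real k"
  have s: "?s > 0"
    using assms(1) by simp
  have "?s * (\<Sum>i=1..k. y i) = (\<Sum>i=1..k. ?s * y i)"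
    by (rule sum_distrib_left)
  also have "\<dots> < (\<Sum>i=1..k. real (nat \<lfloor>?s * y i\<rfloor>) + 1)"
    using assms(1) by (intro sum_strict_mono) (auto simp del: One_nat_def, linarith)
  also have "\<dots> = real (\<Sum>i=1..k. nat \<lfloor>?s * y i\<rfloor>) + real k"
    by (simp add: sum.distrib)
  also have "\<dots> \<le> real n + real k"
    using assms(2) by (intro add_right_mono) (simp only: of_nat_le_iff)
  also have "\<dots> = ?s * 1"
    by simp
  finally show ?thesis
    using s by (simp only: mult_less_cancel_left_pos)
qed

text \<open>Treats both signs of the exponent at once: the 1 covers a \<ge> 0, the other term a < 0.
  With a = \<theta> - 1 this is the origin of the two summands of the majorant below.\<close>

lemma powr_le_one_plus_powr:
  fixes a t u :: real
  assumes "0 < u" "u \<le> t" "t \<le> 1"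
  shows "t powr a \<le> 1 + u powr a"
proof (cases "a \<ge> 0")
  case True
  then have "t powr a \<le> 1"
    using assms by (intro powr_le1) auto
  then show ?thesis
    by (simp add: add_increasing2)
next
  case False
  then have "t powr a \<le> u powr a"
    using assms by (intro powr_mono2') auto
  then show ?thesis
    by simp
qed

text \<open>The majorant for dominated convergence, uniform in \<open>n\<close>. Only points with
  all floors above the cutoff and with floor sum at most \<open>n\<close> matter, and these lie in
  the open simplex.\<close>

lemma lattice_density_quotient_bound:
  assumes "\<theta> > 0" "k \<ge> 1" "x > 0"
  obtains D where "D \<ge> 0"
    "\<And>n y. lattice_density \<theta> (nat \<lfloor>x * (real n + 1)\<rfloor>) (real n + real k) k n y / rising_coeff \<theta> n \<le>
      D * (simplex_density 1 k y + simplex_density \<theta> k y)"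
proof -
  obtain C where C: "C > 0"
    "\<And>n M. rising_coeff \<theta> M / rising_coeff \<theta> n \<le> C * ((real M + 1) / (real n + 1)) powr (\<theta> - 1)"
    using rising_coeff_bounds[OF assms(1)] by blast
  \<comment> \<open>\<open>E\<close> absorbs the factor 1/k in the lower bound (1 - S)/k for (M +
    1)/(n + 1), where S is the coordinate sum and M the remaining index. In \<open>D\<close>, the
    power of k/x bounds the product of the s / a_i, by s \<le> k (n + 1) and a_i > x (n +
    1).\<close>
  define E where "E = 1 + (1 / real k) powr (\<theta> - 1)"
  define D where "D = (real k / x) ^ k * C * E"
  have E: "E \<ge> 1" "(1 / real k) powr (\<theta> - 1) \<le> E"
    by (simp_all add: E_def)
  have D: "D \<ge> 0"
    using C(1) E(1) assms by (simp add: D_def)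
  show ?thesis
  proof (rule that[OF D])
    fix n :: nat and y :: "nat \<Rightarrow> real"
    define s where "s = real n + real k"
    define m where "m = nat \<lfloor>x * (real n + 1)\<rfloor>"
    define a where "a = (\<lambda>i. nat \<lfloor>s * y i\<rfloor>)"
    have s: "s > 0" "s \<ge> real n + 1" "s \<le> real k * (real n + 1)"
      using assms(2) mult_right_mono[of 1 "real k" "real n"] by (simp_all add: s_def algebra_simps)
    have m: "real m + 1 > x * (real n + 1)"
      unfolding m_def by linarith
    have RHS: "0 \<le> D * (simplex_density 1 k y + simplex_density \<theta> k y)"
      using D by (simp add: simplex_density_nonneg)
    consider "\<exists>i\<in>{1..k}. a i \<le> m" | "(\<Sum>i=1..k. a i) > n" |
      "\<forall>i\<in>{1..k}. m < a i" "(\<Sum>i=1..k. a i) \<le> n"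
      by (meson not_less)
    then have "lattice_density \<theta> m s k n y / rising_coeff \<theta> n \<le>
      D * (simplex_density 1 k y + simplex_density \<theta> k y)"
    proof cases
      case 1
      then have "lattice_density \<theta> m s k n y = 0"
        unfolding a_def by (auto intro: lattice_density_eq_0)
      then show ?thesis
        using RHS by simp
    next
      case 2
      then have "lattice_density \<theta> m s k n y = 0"
        by (simp add: a_def lattice_density_def)
      then show ?thesis
        using RHS by simp
    next
      case 3
      let ?S = "\<Sum>i=1..k. y i" and ?M = "n - (\<Sum>i=1..k. a i)"
      have S: "?S < 1"
        using sum_less_1_if_floor_sum_le[OF assms(2), of n y] 3(2) by (simp only: a_def s_def)
      have a: "a i \<ge> 1" "real (a i) \<le> s * y i" "real (a i) > x * (real n + 1)" if "i \<in> {1..k}" for i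
      proof -
        have "a i > m"
          using 3(1) that by auto
        then show "a i \<ge> 1" "real (a i) > x * (real n + 1)"
          using m by linarith+
        from \<open>a i \<ge> 1\<close> show "real (a i) \<le> s * y i"
          unfolding a_def by linarith
      qed
      have y: "y i > 0" if "i \<in> {1..k}" for i
      proof -
        have "0 < s * y i"
          using a[OF that] by linarith
        then show ?thesis
          using s(1) by (simp add: zero_less_mult_iff)
      qed
      have M: "real ?M = real n - (\<Sum>i=1..k. real (a i))"
        using 3(2) by (simp add: of_nat_diff del: One_nat_def)
      have prod: "(\<Prod>i=1..k. s / real (a i)) \<le> (real k / x) ^ k"
      proof -
        have "s / real (a i) \<le> real k / x" if i: "i \<in> {1..k}" for i
        proof -
          have "s * x \<le> real k * (real n + 1) * x"
            using s(3) assms(3) by (intro mult_right_mono) auto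
          also have "\<dots> \<le> real k * real (a i)"
            using mult_left_mono[of "x * (real n + 1)" "real (a i)" "real k"] a(3)[OF i]
              by (simp add: mult_ac)
          finally show ?thesis
            using a(1)[OF i] assms(3) by (simp add: field_simps)
        qed
        then have "(\<Prod>i=1..k. s / real (a i)) \<le> (\<Prod>i=1..k. real k / x)"
          using s(1) by (intro prod_mono) auto
        then show ?thesis
          by simp
      qed
      \<comment> \<open>Rounding down only shrinks the lattice sum, so M \<ge> n - s S = s (1 - S) -
        k. Replacing M + k by k (M + 1) makes the bound multiplicative.\<close>
      have "(\<Sum>i=1..k. real (a i)) \<le> s * ?S"
        unfolding sum_distrib_left using a(2) by (rule sum_mono)
      then have "s * (1 - ?S) \<le> real ?M + real k"
        by (simp only: M s_def algebra_simps)
      also have "\<dots> \<le> real k * (real ?M + 1)"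
        using assms(2) mult_right_mono[of 1 "real k" "real ?M"] by (simp add: algebra_simps)
      finally have "s * (1 - ?S) \<le> real k * (real ?M + 1)" .
      moreover have "(real n + 1) * (1 - ?S) \<le> s * (1 - ?S)"
        using s(2) S by (intro mult_right_mono) auto
      ultimately have "(real n + 1) * (1 - ?S) \<le> real k * (real ?M + 1)"
        by linarith
      then have "(1 - ?S) / real k \<le> (real ?M + 1) / (real n + 1)"
        using assms(2) by (simp add: field_simps)
      moreover have "(real ?M + 1) / (real n + 1) \<le> 1"
        by simp
      ultimately have "((real ?M + 1) / (real n + 1)) powr (\<theta> - 1) \<le>
        1 + ((1 - ?S) / real k) powr (\<theta> - 1)"
        using S assms(2) by (intro powr_le_one_plus_powr) auto
      also have "((1 - ?S) / real k) powr (\<theta> - 1) =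
        (1 - ?S) powr (\<theta> - 1) * (1 / real k) powr (\<theta> - 1)"
        using S powr_mult[of "1 - ?S" "1 / real k" "\<theta> - 1"] by simp
      also have "1 + \<dots> \<le> E * 1 + (1 - ?S) powr (\<theta> - 1) * E"
        using E by (intro add_mono mult_left_mono) auto
      also have "\<dots> = E * (simplex_density 1 k y + simplex_density \<theta> k y)"
        using S y by (simp add: simplex_density_def algebra_simps)
      finally have pw: "((real ?M + 1) / (real n + 1)) powr (\<theta> - 1) \<le>
        E * (simplex_density 1 k y + simplex_density \<theta> k y)" .
      have "lattice_density \<theta> m s k n y / rising_coeff \<theta> n =
        (\<Prod>i=1..k. s / real (a i)) * (rising_coeff \<theta> ?M / rising_coeff \<theta> n)"
        using lattice_density_eq[of k m s y n \<theta>] 3 by (simp add: a_def del: One_nat_def)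
      also have "\<dots> \<le> (real k / x) ^ k * (C * (E * (simplex_density 1 k y + simplex_density \<theta> k y)))"
      proof (rule mult_mono[OF prod])
        show "rising_coeff \<theta> ?M / rising_coeff \<theta> n \<le>
          C * (E * (simplex_density 1 k y + simplex_density \<theta> k y))"
          using C(2)[of ?M n] mult_left_mono[OF pw, of C] C(1) by linarith
      qed (use assms rising_coeff_pos[OF assms(1)] in \<open>auto simp: less_imp_le\<close>)
      finally show ?thesis
        by (simp add: D_def mult.assoc)
    qed
    then show "lattice_density \<theta> (nat \<lfloor>x * (real n + 1)\<rfloor>) (real n + real k) k n y /
      rising_coeff \<theta> n \<le>
        D * (simplex_density 1 k y + simplex_density \<theta> k y)"
      by (simp only: m_def s_def)
  qed
qed

text \<open>Inside the region the floors divided by n + 1 converge to the coordinates. On the face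
  with coordinate sum 1 and beyond, every step function vanishes exactly, thanks to the scale n +
  k.\<close>

lemma lattice_density_quotient_tendsto:
  assumes "\<theta> > 0" "k \<ge> 1" "x > 0" "\<forall>i\<in>{1..k}. y i \<noteq> x"
  shows "(\<lambda>n. lattice_density \<theta> (nat \<lfloor>x * (real n + 1)\<rfloor>) (real n + real k) k n y / rising_coeff \<theta> n)
    \<longlonglongrightarrow> limit_density \<theta> x k y"
proof -
  let ?a = "\<lambda>n i. nat \<lfloor>(real n + real k) * y i\<rfloor>" and ?m = "\<lambda>n::nat. nat \<lfloor>x * (real n + 1)\<rfloor>"
  let ?f = "\<lambda>n. lattice_density \<theta> (?m n) (real n + real k) k n y"
  have scale: "(\<lambda>n. (real n + real k) / (real n + 1)) \<longlonglongrightarrow> 1"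
    by real_asymp
  consider i where "i \<in> {1..k}" "y i < x" | "\<forall>i\<in>{1..k}. y i > x" "(\<Sum>i=1..k. y i) \<ge> 1"
    | "\<forall>i\<in>{1..k}. y i > x" "(\<Sum>i=1..k. y i) < 1"
    using assms(4) by (meson not_less linorder_neqE_linordered_idom)
  then show ?thesis
  proof cases
    case 1
    have "(\<lambda>n. (real n + real k) / (real n + 1) * y i) \<longlonglongrightarrow> 1 * y i"
      by (intro tendsto_mult scale tendsto_const)
    then have "eventually (\<lambda>n. (real n + real k) / (real n + 1) * y i < x) sequentially"
      using 1(2) by (intro order_tendstoD) auto
    then have "eventually (\<lambda>n. ?f n / rising_coeff \<theta> n = 0) sequentially"
    proof eventually_elim
      case (elim n)
      then have "(real n + real k) * y i \<le> x * (real n + 1)"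
        by (simp add: field_simps)
      then have "?a n i \<le> ?m n"
        by (intro nat_mono floor_mono)
      then show ?case
        using lattice_density_eq_0[OF 1(1)] by simp
    qed
    moreover have "limit_density \<theta> x k y = 0"
      using 1 by (force simp: limit_density_def)
    ultimately show ?thesis
      by (simp add: tendsto_eventually)
  next
    case 2
    have "?f n = 0" for n
      using sum_less_1_if_floor_sum_le[OF assms(2), of n y] 2(2) by (auto simp: lattice_density_def)
    moreover have "limit_density \<theta> x k y = 0"
      using 2 by (simp add: limit_density_def)
    ultimately show ?thesis
      by simp
  next
    case 3
    have ypos: "y i > 0" if "i \<in> {1..k}" for i
      using 3(1) assms(3) that by (meson less_trans)
    have lim: "(\<lambda>n. real (?a n i) / (real n + 1)) \<longlonglongrightarrow> y i" if "i \<in> {1..k}" for i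
      using ypos[OF that] by (intro floor_quotient_tendsto) auto
    have limsum: "(\<lambda>n. real (\<Sum>i=1..k. ?a n i) / (real n + 1)) \<longlonglongrightarrow> (\<Sum>i=1..k. y i)"
      unfolding of_nat_sum sum_divide_distrib by (intro tendsto_sum lim)
    have "eventually (\<lambda>n. real (?a n i) / (real n + 1) > x) sequentially" if "i \<in> {1..k}" for i
      using order_tendstoD(1)[OF lim[OF that], of x] 3(1) that by auto
    then have "eventually (\<lambda>n. \<forall>i\<in>{1..k}. real (?a n i) / (real n + 1) > x) sequentially"
      by (intro eventually_ball_finite) auto
    then have ev1: "eventually (\<lambda>n. \<forall>i\<in>{1..k}. ?m n < ?a n i \<or> ?a n i = 0) sequentially"
    proof eventually_elim
      case (elim n)
      show ?case
      proof
        fix i assume "i \<in> {1..k}"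
        then have "x * (real n + 1) < real (?a n i)"
          using elim by (simp add: field_simps)
        moreover have "real (?m n) \<le> x * (real n + 1)"
          using assms(3) by simp
        ultimately show "?m n < ?a n i \<or> ?a n i = 0"
          by linarith
      qed
    qed
    have ev2: "eventually (\<lambda>n. (\<Sum>i=1..k. ?a n i) \<le> n) sequentially"
      using order_tendstoD(2)[OF limsum 3(2)]
    proof eventually_elim
      case (elim n)
      then have "real (\<Sum>i=1..k. ?a n i) < real n + 1"
        by (simp add: field_simps)
      then show ?case
        by linarith
    qed
    have "(\<lambda>n. (real n + 1 - real (\<Sum>i=1..k. ?a n i)) / (real n + 1)) \<longlonglongrightarrow> 1 - (\<Sum>i=1..k. y i)"
    proof -
      have "(real n + 1 - real (\<Sum>i=1..k. ?a n i)) / (real n + 1) =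
        1 - real (\<Sum>i=1..k. ?a n i) / (real n + 1)" for n
        by (simp only: diff_divide_distrib) simp
      then show ?thesis
        using limsum by (simp only:) (intro tendsto_diff tendsto_const)
    qed
    \<comment> \<open>Eventually the lattice sum is at most \<open>n\<close>, so the natural
      subtraction is exact; the added 1 is the shift that
      \<open>rising_coeff_quotient_tendsto\<close> expects.\<close>
    then have "(\<lambda>n. (real (n - (\<Sum>i=1..k. ?a n i)) + 1) / (real n + 1)) \<longlonglongrightarrow> 1 - (\<Sum>i=1..k. y i)"
      by (rule Lim_transform_eventually) (use ev2 in eventually_elim, simp only: of_nat_diff, simp)
    then have "(\<lambda>n. rising_coeff \<theta> (n - (\<Sum>i=1..k. ?a n i)) / rising_coeff \<theta> n)
      \<longlonglongrightarrow> (1 - (\<Sum>i=1..k. y i)) powr (\<theta> - 1)"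
      using 3(2) by (intro rising_coeff_quotient_tendsto assms) auto
    moreover have "(\<lambda>n. (real n + real k) / real (?a n i)) \<longlonglongrightarrow> 1 / y i" if "i \<in> {1..k}" for i
    proof -
      have "(\<lambda>n. ((real n + real k) / (real n + 1)) / (real (?a n i) / (real n + 1))) \<longlonglongrightarrow> 1 / y i"
        using ypos[OF that] by (intro tendsto_divide scale lim[OF that]) auto
      moreover have "((real n + real k) / (real n + 1)) / (real (?a n i) / (real n + 1)) =
        (real n + real k) / real (?a n i)" for n
      proof -
        have "real n + 1 \<noteq> 0"
          by linarith
        then show ?thesis
          by (simp add: divide_simps)
      qed
      ultimately show ?thesis
        by (simp only:)
    qed
    ultimately have L: "(\<lambda>n. (\<Prod>i=1..k. (real n + real k) / real (?a n i)) *
      (rising_coeff \<theta> (n - (\<Sum>i=1..k. ?a n i)) / rising_coeff \<theta> n))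
        \<longlonglongrightarrow> (\<Prod>i=1..k. 1 / y i) * (1 - (\<Sum>i=1..k. y i)) powr (\<theta> - 1)"
      by (intro tendsto_mult tendsto_prod)
    have eq: "(\<Prod>i=1..k. 1 / y i) * (1 - (\<Sum>i=1..k. y i)) powr (\<theta> - 1) = limit_density \<theta> x k y"
      using 3 by (simp add: limit_density_def prod_dividef)
    have "eventually (\<lambda>n. (\<Prod>i=1..k. (real n + real k) / real (?a n i)) *
      (rising_coeff \<theta> (n - (\<Sum>i=1..k. ?a n i)) / rising_coeff \<theta> n)
        = ?f n / rising_coeff \<theta> n) sequentially"
      using ev1 ev2
    proof eventually_elim
      case (elim n)
      show ?case
      proof (cases "\<exists>i\<in>{1..k}. ?a n i = 0")
        case True
        then obtain i where i: "i \<in> {1..k}" "?a n i = 0"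
          by blast
        then have "(\<Prod>i=1..k. (real n + real k) / real (?a n i)) = 0"
          by (intro prod_zero bexI[of _ i]) auto
        moreover have "?f n = 0"
          using i by (intro lattice_density_eq_0[of i]) auto
        ultimately show ?thesis
          by (simp only: mult_zero_left div_0)
      next
        case False
        then have "\<forall>i\<in>{1..k}. ?m n < ?a n i"
          using elim(1) by blast
        then show ?thesis
          using lattice_density_eq[OF _ elim(2)] by (simp only: times_divide_eq_right)
      qed
    qed
    then show ?thesis
      using Lim_transform_eventually[OF L] by (simp only: eq)
  qed
qed

text \<open>By \<open>integral_lattice_density\<close> the coefficient is the integral of the step
  function at every scale, so the scale may be taken as n + k, varying with
  \<open>n\<close>.\<close>

theorem large_cycles_power_quotient_tendsto:
  assumes "\<theta> > 0" "k \<ge> 1" "x > 0"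
  shows "(\<lambda>n. (large_cycles (nat \<lfloor>x * (real n + 1)\<rfloor>) ^ k * Abs_fps (rising_coeff \<theta>)) $ n /
    rising_coeff \<theta> n)
    \<longlonglongrightarrow> (LINT y|Pi\<^sub>M {1..k} (\<lambda>_. lborel). limit_density \<theta> x k y)"
proof -
  obtain D where D: "D \<ge> 0"
    "\<And>n y. lattice_density \<theta> (nat \<lfloor>x * (real n + 1)\<rfloor>) (real n + real k) k n y / rising_coeff \<theta> n \<le>
      D * (simplex_density 1 k y + simplex_density \<theta> k y)"
    using lattice_density_quotient_bound[OF assms] by blast
  let ?g = "\<lambda>n y. lattice_density \<theta> (nat \<lfloor>x * (real n + 1)\<rfloor>) (real n + real k) k n y /
    rising_coeff \<theta> n"
  have "(\<lambda>n. LINT y|Pi\<^sub>M {1..k} (\<lambda>_. lborel). ?g n y)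
    \<longlonglongrightarrow> (LINT y|Pi\<^sub>M {1..k} (\<lambda>_. lborel). limit_density \<theta> x k y)"
  proof (rule integral_dominated_convergence)
    show "integrable (Pi\<^sub>M {1..k} (\<lambda>_. lborel)) (\<lambda>y. D * (simplex_density 1 k y +
      simplex_density \<theta> k y))"
      by (intro integrable_mult_right Bochner_Integration.integrable_add integrable_simplex_density assms) simp
    show "AE y in Pi\<^sub>M {1..k} (\<lambda>_. lborel). (\<lambda>n. ?g n y) \<longlonglongrightarrow> limit_density \<theta> x k y"
      using AE_component_neq[of k x] by eventually_elim (rule lattice_density_quotient_tendsto[OF assms])
    show "AE y in Pi\<^sub>M {1..k} (\<lambda>_. lborel). norm (?g n y) \<le>
      D * (simplex_density 1 k y + simplex_density \<theta> k y)" for n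
    proof (intro AE_I2)
      fix y
      have "0 \<le> lattice_density \<theta> (nat \<lfloor>x * (real n + 1)\<rfloor>) (real n + real k) k n y"
        using assms by (intro lattice_density_nonneg) auto
      then have "0 \<le> ?g n y"
        using rising_coeff_pos[OF assms(1), of n] by simp
      then show "norm (?g n y) \<le> D * (simplex_density 1 k y + simplex_density \<theta> k y)"
        using D(2)[of n y] by simp
    qed
  qed measurable
  moreover have "(LINT y|Pi\<^sub>M {1..k} (\<lambda>_. lborel). ?g n y) =
      (large_cycles (nat \<lfloor>x * (real n + 1)\<rfloor>) ^ k * Abs_fps (rising_coeff \<theta>)) $ n /
        rising_coeff \<theta> n" for n
    using assms by (simp only: integral_divide_zero) (subst integral_lattice_density, auto)
  ultimately show ?thesis
    by (simp only:)
qed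

subsection \<open>The limit law of the largest branch\<close>

definition limit_term :: "real \<Rightarrow> nat \<Rightarrow> real \<Rightarrow> real" where
  "limit_term \<theta> k x = (if k = 0 then 1 else LINT y|Pi\<^sub>M {1..k} (\<lambda>_. lborel). limit_density \<theta> x k y)"

lemma limit_term_eq_0:
  assumes "x > 0" "k \<ge> 1" "real k * x \<ge> 1"
  shows "limit_term \<theta> k x = 0"
proof -
  have "limit_density \<theta> x k = (\<lambda>y. 0)"
    using limit_density_eq_0[OF assms] by blast
  then show ?thesis
    using assms(2) by (simp add: limit_term_def)
qed

text \<open>All prefactors of \<open>F_theta\<close> cancel against those of \<open>p_theta\<close>
  at 1/x, leaving the bracket.\<close>

lemma F_theta_eq_suminf:
  assumes "\<theta> > 0" "x > 0"
  shows "F_theta \<theta> x = 1 + (\<Sum>m. let k = Suc m in (- \<theta>) ^ k / fact k *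
    (LINT y:simplex_region k (1 / x)|Pi\<^sub>M {1..k} (\<lambda>_. lborel).
      (1 - (\<Sum>j=1..k. y j)) powr (\<theta> - 1) / (\<Prod>j=1..k. y j)))"
  (is "_ = 1 + ?S")
proof -
  have G: "Gamma \<theta> > 0"
    using assms(1) by (rule Gamma_real_pos)
  have "F_theta \<theta> x = (exp (euler_mascheroni * \<theta>) * exp (- euler_mascheroni * \<theta>)) *
      (x powr (\<theta> - 1) * (1 / x) powr (\<theta> - 1)) * (Gamma \<theta> / Gamma \<theta>) * (1 + ?S)"
    unfolding F_theta_def p_theta_def
      by (simp only: times_divide_eq_left times_divide_eq_right mult_ac)
  also have "exp (euler_mascheroni * \<theta>) * exp (- euler_mascheroni * \<theta>) = (1::real)"
    by (simp flip: exp_add)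
  also have "x powr (\<theta> - 1) * (1 / x) powr (\<theta> - 1) = 1"
    using assms(2) by (simp flip: powr_mult)
  finally show ?thesis
    using G by simp
qed

text \<open>Any \<open>K\<close> with (K + 1) x \<ge> 1 is allowed, not only the least, so one
  finite sum represents \<open>F_theta\<close> on a whole half-line; right continuity relies on
  this.\<close>

lemma F_theta_eq:
  assumes "\<theta> > 0" "x > 0" "real (Suc K) * x \<ge> 1"
  shows "F_theta \<theta> x = (\<Sum>k\<le>K. (- \<theta>) ^ k / fact k * limit_term \<theta> k x)"
proof -
  let ?f = "\<lambda>k. (- \<theta>) ^ k / fact k * limit_term \<theta> k x"
  have "F_theta \<theta> x = 1 + (\<Sum>m. ?f (Suc m))"
    unfolding F_theta_eq_suminf[OF assms(1,2)] Let_def LINT_simplex_region[OF assms(2)]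
    by (simp add: limit_term_def)
  also have "(\<Sum>m. ?f (Suc m)) = (\<Sum>m<K. ?f (Suc m))"
  proof (rule suminf_finite)
    fix m assume "m \<notin> {..<K}"
    then have "real (Suc K) * x \<le> real (Suc m) * x"
      using assms(2) by (intro mult_right_mono) auto
    then have "1 \<le> real (Suc m) * x"
      using assms(3) by linarith
    then have "limit_term \<theta> (Suc m) x = 0"
      by (intro limit_term_eq_0 assms(2)) simp
    then show "?f (Suc m) = 0"
      by simp
  qed simp
  also have "1 + (\<Sum>m<K. ?f (Suc m)) = (\<Sum>k\<le>K. ?f k)"
    by (simp add: sum.atMost_shift limit_term_def)
  finally show ?thesis .
qed

lemma F_theta_ge_1:
  assumes "\<theta> > 0" "x \<ge> 1"
  shows "F_theta \<theta> x = 1"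
  using F_theta_eq[of \<theta> x 0] assms by (simp add: limit_term_def)

abbreviation branch_cdf :: "real \<Rightarrow> nat \<Rightarrow> real \<Rightarrow> real" where
  "branch_cdf \<theta> n x \<equiv> measure_pmf.prob (hoppe_tree \<theta> n) {T. real (largest_branch n T) \<le> x * real n}"

text \<open>The tree has n + 1 nodes, hence the cutoff x (n + 1), while the coefficient has index n,
  the number of nodes below the root.\<close>

lemma branch_cdf_eq:
  assumes "\<theta> > 0" "x \<ge> 0"
  shows "branch_cdf \<theta> (Suc n) x =
    ewens_fps \<theta> (\<lambda>j. if j \<le> nat \<lfloor>x * (real n + 1)\<rfloor> then 1 else 0) $ n / rising_coeff \<theta> n"
proof -
  have "real l \<le> x * real (Suc n) \<longleftrightarrow> l \<le> nat \<lfloor>x * (real n + 1)\<rfloor>" for l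
    using assms(2) by (simp add: le_nat_iff le_floor_iff add.commute)
  then show ?thesis
    unfolding prob_largest_branch_le[OF assms(1), symmetric] by (simp only:)
qed

text \<open>One \<open>K\<close>, depending on \<open>x\<close> alone, cuts off the expansion for
  every \<open>n\<close> as well as the limiting series, so the limit is taken inside a fixed finite
  sum.\<close>

theorem branch_cdf_tendsto:
  assumes "\<theta> > 0" "x > 0"
  shows "(\<lambda>n. branch_cdf \<theta> n x) \<longlonglongrightarrow> F_theta \<theta> x"
proof -
  let ?W = "\<lambda>n k. (large_cycles (nat \<lfloor>x * (real n + 1)\<rfloor>) ^ k * Abs_fps (rising_coeff \<theta>)) $ n"
  obtain K :: nat where "1 / x < real K"
    using reals_Archimedean2 by blast
  then have K: "real (Suc K) * x \<ge> 1"
    using assms(2) by (simp add: field_simps)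
  have "branch_cdf \<theta> (Suc n) x = (\<Sum>k\<le>K. (- \<theta>) ^ k / fact k * (?W n k / rising_coeff \<theta> n))" for n
  proof -
    let ?m = "nat \<lfloor>x * (real n + 1)\<rfloor>"
    have "real n < 1 * (real n + 1)"
      by simp
    also have "\<dots> \<le> real (Suc K) * x * (real n + 1)"
      by (rule mult_right_mono[OF K]) simp
    also have "\<dots> = real (Suc K) * (x * (real n + 1))"
      by simp
    also have "\<dots> \<le> real (Suc K) * real (Suc ?m)"
      by (intro mult_left_mono) linarith+
    finally have "n < Suc K * Suc ?m"
      by (simp only: of_nat_mult[symmetric] of_nat_less_iff)
    then show ?thesis
      using assms by (subst branch_cdf_eq)
        (auto simp: ewens_fps_truncated_nth sum_divide_distrib large_cycles_def)
  qed
  moreover have "(\<lambda>n. \<Sum>k\<le>K. (- \<theta>) ^ k / fact k * (?W n k / rising_coeff \<theta> n))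
      \<longlonglongrightarrow> (\<Sum>k\<le>K. (- \<theta>) ^ k / fact k * limit_term \<theta> k x)"
  proof (intro tendsto_sum tendsto_mult_left)
    fix k
    show "(\<lambda>n. ?W n k / rising_coeff \<theta> n) \<longlonglongrightarrow> limit_term \<theta> k x"
    proof (cases "k = 0")
      case True
      have "rising_coeff \<theta> n \<noteq> 0" for n
        using rising_coeff_pos[OF assms(1), of n] by simp
      with True show ?thesis
        by (simp add: limit_term_def)
    next
      case False
      then show ?thesis
        using large_cycles_power_quotient_tendsto[OF assms(1) _ assms(2), of k]
          by (simp add: limit_term_def)
    qed
  qed
  ultimately have "(\<lambda>n. branch_cdf \<theta> (Suc n) x) \<longlonglongrightarrow> F_theta \<theta> x"
    using F_theta_eq[OF assms K] by simp
  then show ?thesis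
    by (rule LIMSEQ_imp_Suc)
qed

text \<open>A tree with at least two nodes has a nonempty branch. In the series, truncation at 0
  leaves no weights, so every coefficient of positive index vanishes; hence the double
  \<open>Suc\<close>.\<close>

lemma branch_cdf_0_tendsto:
  assumes "\<theta> > 0"
  shows "(\<lambda>n. branch_cdf \<theta> n 0) \<longlonglongrightarrow> 0"
proof -
  have "branch_cdf \<theta> (Suc (Suc n)) 0 = 0" for n
    using assms by (subst branch_cdf_eq) (auto simp: ewens_fps_nth_Suc sum.neutral)
  then have "(\<lambda>n. branch_cdf \<theta> (Suc (Suc n)) 0) \<longlonglongrightarrow> 0"
    by (simp only: tendsto_const)
  then show ?thesis
    by (rule LIMSEQ_imp_Suc[OF LIMSEQ_imp_Suc])
qed

text \<open>The quotient of the two sides is a probability.\<close>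

lemma ewens_fps_truncated_le_rising_coeff:
  assumes "\<theta> > 0"
  shows "ewens_fps \<theta> (\<lambda>j. if j \<le> m then 1 else 0) $ n \<le> rising_coeff \<theta> n"
  using prob_largest_branch_le[OF assms, of n m]
    measure_pmf.prob_le_1[of "hoppe_tree \<theta> (Suc n)" "{T. largest_branch (Suc n) T \<le> m}"]
    rising_coeff_pos[OF assms, of n]
  by (simp add: divide_le_eq)

text \<open>
  This excludes an atom of the limit law at \<open>0\<close>. It comes from the recursion
  \<open>n h\<^sub>n = \<theta> (h\<^sub>n\<^sub>-\<^sub>1 + \<dots> + h\<^sub>n\<^sub>-\<^sub>m)\<close> for the coefficients \<open>h\<^sub>n\<close> of the truncated
  series, in which every \<open>h\<^sub>i\<close> is at most \<^term>\<open>rising_coeff \<theta> i\<close>.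
\<close>

lemma F_theta_small:
  assumes "\<theta> > 0"
  obtains D where "\<And>x. 0 < x \<Longrightarrow> x \<le> 1 / 4 \<Longrightarrow> F_theta \<theta> x \<le> D * x"
proof -
  obtain C where C: "C > 0"
    "\<And>n M. rising_coeff \<theta> M / rising_coeff \<theta> n \<le> C * ((real M + 1) / (real n + 1)) powr (\<theta> - 1)"
    using rising_coeff_bounds[OF assms] by blast
  \<comment> \<open>For x \<le> 1/4 the recursion looks back over at most about a quarter of the
    indices, so n - i stays above a fixed fraction of n; 1/4 is a safe lower bound for the ratio
    under \<open>powr\<close>.\<close>
  define E where "E = C * (1 + (1 / 4) powr (\<theta> - 1))"
  have E: "E \<ge> 0"
    using C(1) by (simp add: E_def)
  have "F_theta \<theta> x \<le> (\<theta> * E) * x" if x: "0 < x" "x \<le> 1 / 4" for x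
  proof (rule LIMSEQ_le)
    show "(\<lambda>n. branch_cdf \<theta> (Suc (Suc n)) x) \<longlonglongrightarrow> F_theta \<theta> x"
      by (intro LIMSEQ_Suc branch_cdf_tendsto assms x)
    have "(\<lambda>n. (real n + 2) / (real n + 1)) \<longlonglongrightarrow> 1"
      by real_asymp
    then have "(\<lambda>n. \<theta> * E * x * ((real n + 2) / (real n + 1))) \<longlonglongrightarrow> \<theta> * E * x * 1"
      by (rule tendsto_mult_left)
    then show "(\<lambda>n. \<theta> * E * x * ((real n + 2) / (real n + 1))) \<longlonglongrightarrow> \<theta> * E * x"
      by simp
    have "branch_cdf \<theta> (Suc (Suc n)) x \<le> \<theta> * E * x * ((real n + 2) / (real n + 1))" for n
    proof -
      let ?m = "nat \<lfloor>x * (real (Suc n) + 1)\<rfloor>"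
      let ?H = "ewens_fps \<theta> (\<lambda>j. if j \<le> ?m then 1 else 0)"
      have m: "real ?m \<le> x * (real n + 2)"
        using x(1) by (simp add: add.commute)
      have "(if Suc i \<le> ?m then 1 else 0) * ?H $ (n - i) / rising_coeff \<theta> (Suc n) \<le> (if i <
        ?m then E else 0)"
        if i: "i \<in> {0..n}" for i
      proof (cases "i < ?m")
        case True
        have "x * (real n + 2) \<le> 1 / 4 * (real n + 2)"
          using x by (intro mult_right_mono) auto
        then have "real (Suc i) \<le> (real n + 2) / 4"
          using m True by linarith
        then have "1 / 4 \<le> (real (n - i) + 1) / (real (Suc n) + 1)"
          using i by (simp add: field_simps of_nat_diff)
        moreover have "(real (n - i) + 1) / (real (Suc n) + 1) \<le> 1"
          by simp
        ultimately have "((real (n - i) + 1) / (real (Suc n) + 1)) powr (\<theta> - 1) \<le>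
          1 + (1 / 4) powr (\<theta> - 1)"
          by (intro powr_le_one_plus_powr) auto
        then have "C * ((real (n - i) + 1) / (real (Suc n) + 1)) powr (\<theta> - 1) \<le> E"
          unfolding E_def using C(1) by (intro mult_left_mono) auto
        then have "rising_coeff \<theta> (n - i) / rising_coeff \<theta> (Suc n) \<le> E"
          using C(2)[of "n - i" "Suc n"] by linarith
        moreover have "?H $ (n - i) / rising_coeff \<theta> (Suc n) \<le>
          rising_coeff \<theta> (n - i) / rising_coeff \<theta> (Suc n)"
          using rising_coeff_pos[OF assms, of "Suc n"]
          by (intro divide_right_mono ewens_fps_truncated_le_rising_coeff assms) auto
        ultimately show ?thesis
          using True by simp
      qed simp
      then have "(\<Sum>i=0..n. (if Suc i \<le> ?m then 1 else 0) * ?H $ (n - i) / rising_coeff \<theta> (Suc n))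
          \<le> (\<Sum>i=0..n. if i < ?m then E else 0)"
        by (rule sum_mono)
      also have "\<dots> = (\<Sum>i\<in>{0..n} \<inter> {i. i < ?m}. E)"
        by (subst sum.inter_restrict) auto
      also have "\<dots> \<le> (\<Sum>i<?m. E)"
        using E by (intro sum_mono2) auto
      also have "\<dots> \<le> x * (real n + 2) * E"
        using mult_right_mono[OF m E] by simp
      finally have *: "(\<Sum>i=0..n. (if Suc i \<le>
        ?m then 1 else 0) * ?H $ (n - i) / rising_coeff \<theta> (Suc n))
          \<le> x * (real n + 2) * E" .
      have "branch_cdf \<theta> (Suc (Suc n)) x = \<theta> / real (Suc n) *
          (\<Sum>i=0..n. (if Suc i \<le> ?m then 1 else 0) * ?H $ (n - i) / rising_coeff \<theta> (Suc n))"
        using assms x by (subst branch_cdf_eq) (auto simp: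
          ewens_fps_nth_Suc sum_divide_distrib[symmetric])
      also have "\<dots> \<le> \<theta> / real (Suc n) * (x * (real n + 2) * E)"
        using assms by (intro mult_left_mono *) auto
      also have "\<dots> = \<theta> * E * x * ((real n + 2) / (real n + 1))"
        by (simp add: add.commute)
      finally show ?thesis .
    qed
    then show "\<exists>N. \<forall>n\<ge>N. branch_cdf \<theta> (Suc (Suc n)) x \<le> \<theta> * E * x * ((real n + 2) / (real n + 1))"
      by blast
  qed
  then show ?thesis
    by (rule that)
qed

text \<open>This bound and the monotonicity below pass to the limit from the probabilities for
  finite \<open>n\<close>; the alternating series does not display them.\<close>

lemma F_theta_nonneg: "\<theta> > 0 \<Longrightarrow> x > 0 \<Longrightarrow> 0 \<le> F_theta \<theta> x"
  by (rule LIMSEQ_le_const[OF branch_cdf_tendsto]) auto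

lemma F_theta_mono:
  assumes "\<theta> > 0" "0 < x" "x \<le> z"
  shows "F_theta \<theta> x \<le> F_theta \<theta> z"
proof (rule LIMSEQ_le[OF branch_cdf_tendsto branch_cdf_tendsto])
  have "branch_cdf \<theta> n x \<le> branch_cdf \<theta> n z" for n
    using assms mult_right_mono[of x z "real n"]
    by (intro measure_pmf.finite_measure_mono) (auto intro: order_trans)
  then show "\<exists>N. \<forall>n\<ge>N. branch_cdf \<theta> n x \<le> branch_cdf \<theta> n z"
    by blast
qed (use assms in auto)

text \<open>Dominated convergence along any sequence S n > x tending to x, with the density at
  \<open>x\<close> as majorant. The inequalities x < y_i are strict, so a point that satisfies them
  also satisfies S n < y_i for large n, and the densities converge at every point.\<close>

lemma limit_term_right_continuous:
  assumes "\<theta> > 0" "x > 0"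
  shows "(limit_term \<theta> k \<longlongrightarrow> limit_term \<theta> k x) (at_right x)"
proof (cases "k = 0")
  case False
  then have k: "k \<ge> 1"
    by simp
  show ?thesis
  proof (rule tendsto_at_right_sequentially[of x "x + 1"])
    fix S :: "nat \<Rightarrow> real"
    assume S: "\<And>n. x < S n" "S \<longlonglongrightarrow> x"
    have "(\<lambda>n. LINT y|Pi\<^sub>M {1..k} (\<lambda>_. lborel). limit_density \<theta> (S n) k y) \<longlonglongrightarrow>
        (LINT y|Pi\<^sub>M {1..k} (\<lambda>_. lborel). limit_density \<theta> x k y)"
    proof (rule integral_dominated_convergence)
      show "integrable (Pi\<^sub>M {1..k} (\<lambda>_. lborel)) (limit_density \<theta> x k)"
        by (rule integrable_limit_density[OF assms(1) k assms(2)])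
      show "AE y in Pi\<^sub>M {1..k} (\<lambda>_. lborel). norm (limit_density \<theta> (S n) k y) \<le>
        limit_density \<theta> x k y" for n
      proof (intro AE_I2)
        fix y
        have "limit_density \<theta> (S n) k y = (if \<forall>i\<in>{1..k}. S n <
          y i then limit_density \<theta> x k y else 0)"
          using S(1)[of n] by (auto simp: limit_density_def simp del: One_nat_def dest: less_trans)
        then show "norm (limit_density \<theta> (S n) k y) \<le> limit_density \<theta> x k y"
          using limit_density_nonneg[OF assms(2), of \<theta> k y] by simp
      qed
      show "AE y in Pi\<^sub>M {1..k} (\<lambda>_. lborel). (\<lambda>n. limit_density \<theta> (S n) k y)
        \<longlonglongrightarrow> limit_density \<theta> x k y"
      proof (intro AE_I2)
        fix y
        show "(\<lambda>n. limit_density \<theta> (S n) k y) \<longlonglongrightarrow> limit_density \<theta> x k y"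
        proof (cases "\<forall>i\<in>{1..k}. x < y i")
          case True
          then have "eventually (\<lambda>n. \<forall>i\<in>{1..k}. S n < y i) sequentially"
            using order_tendstoD(2)[OF S(2)] by (intro eventually_ball_finite) auto
          then have "eventually (\<lambda>n. limit_density \<theta> (S n) k y =
            limit_density \<theta> x k y) sequentially"
            by eventually_elim (use True in \<open>simp add: limit_density_def del: One_nat_def\<close>)
          then show ?thesis
            by (rule tendsto_eventually)
        next
          case False
          then have "limit_density \<theta> (S n) k y = 0" "limit_density \<theta> x k y = 0" for n
            using S(1)[of n] by (auto simp:
              limit_density_def simp del: One_nat_def dest: less_trans)
          then show ?thesis
            by simp
        qed
      qed
    qed measurable
    then show "(\<lambda>n. limit_term \<theta> k (S n)) \<longlonglongrightarrow> limit_term \<theta> k x"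
      using False by (simp add: limit_term_def)
  qed simp
qed (simp add: limit_term_def[abs_def])

lemma F_theta_right_continuous:
  assumes "\<theta> > 0" "x > 0"
  shows "(F_theta \<theta> \<longlongrightarrow> F_theta \<theta> x) (at_right x)"
proof -
  obtain K :: nat where "1 / x < real K"
    using reals_Archimedean2 by blast
  then have K: "real (Suc K) * x \<ge> 1"
    using assms(2) by (simp add: field_simps)
  have eq: "(\<Sum>k\<le>K. (- \<theta>) ^ k / fact k * limit_term \<theta> k z) = F_theta \<theta> z" if "z \<ge> x" for z
  proof -
    have "real (Suc K) * x \<le> real (Suc K) * z"
      using that by (intro mult_left_mono) auto
    then have "1 \<le> real (Suc K) * z"
      using K by linarith
    then show ?thesis
      using that assms by (intro F_theta_eq[symmetric]) auto
  qed
  have "((\<lambda>z. \<Sum>k\<le>K. (- \<theta>) ^ k / fact k * limit_term \<theta> k z) \<longlongrightarrow>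
      (\<Sum>k\<le>K. (- \<theta>) ^ k / fact k * limit_term \<theta> k x)) (at_right x)"
    by (intro tendsto_sum tendsto_mult_left limit_term_right_continuous assms)
  moreover have "eventually (\<lambda>z. (\<Sum>k\<le>K. (- \<theta>) ^ k / fact k * limit_term \<theta> k z) =
    F_theta \<theta> z) (at_right x)"
    using eventually_at_right_less[of x] by eventually_elim (intro eq less_imp_le)
  ultimately show ?thesis
    unfolding eq[OF order_refl] by (rule Lim_transform_eventually)
qed

section \<open>The limit measure and weak convergence\<close>

definition branch_limit_cdf :: "real \<Rightarrow> real \<Rightarrow> real" where
  "branch_limit_cdf \<theta> x = (if x > 0 then F_theta \<theta> x else 0)"

lemma branch_limit_cdf_right_continuous:
  assumes "\<theta> > 0"
  shows "continuous (at_right x) (branch_limit_cdf \<theta>)"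
  unfolding continuous_within
proof -
  consider "x > 0" | "x = 0" | "x < 0"
    by linarith
  then show "(branch_limit_cdf \<theta> \<longlongrightarrow> branch_limit_cdf \<theta> x) (at_right x)"
  proof cases
    case 1
    have "eventually (\<lambda>z. F_theta \<theta> z = branch_limit_cdf \<theta> z) (at_right x)"
      using eventually_at_right_less[of x]
        by eventually_elim (use 1 in \<open>simp add: branch_limit_cdf_def\<close>)
    with F_theta_right_continuous[OF assms 1] show ?thesis
      using 1 by (simp add: branch_limit_cdf_def[of \<theta> x] Lim_transform_eventually)
  next
    case 2
    obtain D where D: "\<And>x. 0 < x \<Longrightarrow> x \<le> 1 / 4 \<Longrightarrow> F_theta \<theta> x \<le> D * x"
      using F_theta_small[OF assms] by blast
    have ev: "eventually (\<lambda>z::real. 0 < z \<and> z < 1 / 4) (at_right 0)"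
      by (rule eventually_at_rightI[of 0 "1/4"]) auto
    have "(branch_limit_cdf \<theta> \<longlongrightarrow> 0) (at_right 0)"
    proof (rule tendsto_sandwich)
      show "eventually (\<lambda>z. 0 \<le> branch_limit_cdf \<theta> z) (at_right 0)"
        using F_theta_nonneg[OF assms] by (simp add: branch_limit_cdf_def)
      show "eventually (\<lambda>z. branch_limit_cdf \<theta> z \<le> D * z) (at_right 0)"
        using ev by eventually_elim (simp add: branch_limit_cdf_def D)
      have "((\<lambda>z. D * z) \<longlongrightarrow> D * 0) (at_right 0)"
        by (intro tendsto_intros)
      then show "((\<lambda>z. D * z) \<longlongrightarrow> 0) (at_right 0)"
        by simp
    qed auto
    then show ?thesis
      using 2 by (simp add: branch_limit_cdf_def)
  next
    case 3
    have "eventually (\<lambda>z. z \<in> {x<..<0}) (at_right x)"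
      by (rule eventually_at_right_real[OF 3])
    then have "eventually (\<lambda>z. branch_limit_cdf \<theta> z = 0) (at_right x)"
      by eventually_elim (auto simp: branch_limit_cdf_def)
    then show ?thesis
      using 3 by (simp add: branch_limit_cdf_def tendsto_eventually)
  qed
qed

definition branch_limit_distr :: "real \<Rightarrow> real measure" where
  "branch_limit_distr \<theta> = interval_measure (branch_limit_cdf \<theta>)"

text \<open>Monotonicity, right continuity and the limits at both ends are what
  \<open>interval_measure\<close> requires; the value 1 is already reached at x = 1.\<close>

lemma
  assumes "\<theta> > 0"
  shows real_distribution_branch_limit_distr: "real_distribution (branch_limit_distr \<theta>)"
    and cdf_branch_limit_distr: "cdf (branch_limit_distr \<theta>) = branch_limit_cdf \<theta>"
proof -
  have mono: "branch_limit_cdf \<theta> x \<le> branch_limit_cdf \<theta> z" if "x \<le> z" for x z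
    using that F_theta_mono[OF assms, of x z] F_theta_nonneg[OF assms, of z]
      by (auto simp: branch_limit_cdf_def)
  have bot: "(branch_limit_cdf \<theta> \<longlongrightarrow> 0) at_bot"
    by (rule tendsto_eventually, rule eventually_mono[OF eventually_le_at_bot[of 0]])
      (simp add: branch_limit_cdf_def)
  have top: "(branch_limit_cdf \<theta> \<longlongrightarrow> 1) at_top"
    by (rule tendsto_eventually, rule eventually_mono[OF eventually_ge_at_top[of 1]])
      (simp add: branch_limit_cdf_def F_theta_ge_1[OF assms])
  show "real_distribution (branch_limit_distr \<theta>)"
    unfolding branch_limit_distr_def
    by (intro real_distribution_interval_measure mono branch_limit_cdf_right_continuous assms bot top)
  show "cdf (branch_limit_distr \<theta>) = branch_limit_cdf \<theta>"
    unfolding branch_limit_distr_def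
    by (intro cdf_interval_measure mono branch_limit_cdf_right_continuous assms bot)
qed

text \<open>The distribution functions converge at every real point, with 0 and the negative numbers
  treated apart from the series. Shifting the index to \<open>Suc n\<close> avoids the quotient by n
  = 0.\<close>

theorem weak_conv_largest_branch:
  assumes "\<theta> > 0"
  shows "weak_conv_m (\<lambda>n. distr (measure_pmf (hoppe_tree \<theta> n)) borel
    (\<lambda>T. real (largest_branch n T) / real n)) (branch_limit_distr \<theta>)"
  unfolding weak_conv_m_def weak_conv_def
proof (intro allI impI)
  fix x :: real
  let ?c = "\<lambda>n. cdf (distr (measure_pmf (hoppe_tree \<theta> n)) borel (\<lambda>T. real (largest_branch n T) /
    real n)) x"
  have "?c (Suc n) = branch_cdf \<theta> (Suc n) x" for n
    unfolding cdf_def by (subst measure_distr) (auto simp: vimage_def divide_le_eq)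
  moreover have "(\<lambda>n. branch_cdf \<theta> (Suc n) x) \<longlonglongrightarrow> branch_limit_cdf \<theta> x"
  proof -
    consider "x > 0" | "x = 0" | "x < 0"
      by linarith
    then show ?thesis
    proof cases
      case 1
      then show ?thesis
        using branch_cdf_tendsto[OF assms 1, THEN LIMSEQ_Suc] by (simp add: branch_limit_cdf_def)
    next
      case 2
      then show ?thesis
        using branch_cdf_0_tendsto[OF assms, THEN LIMSEQ_Suc] by (simp add: branch_limit_cdf_def)
    next
      case 3
      then have "x * real (Suc n) < 0" for n
        by (intro mult_neg_pos) auto
      then have "{T. real (largest_branch (Suc n) T) \<le> x * real (Suc n)} = {}" for n
        by (metis (no_types, lifting) empty_Collect_eq not_less of_nat_0_le_iff order_less_le_trans)
      then have "branch_cdf \<theta> (Suc n) x = 0" for n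
        by (simp only: measure_empty)
      then show ?thesis
        using 3 by (simp only: branch_limit_cdf_def) simp
    qed
  qed
  ultimately have "(\<lambda>n. ?c (Suc n)) \<longlonglongrightarrow> branch_limit_cdf \<theta> x"
    by (simp only:)
  then show "?c \<longlonglongrightarrow> cdf (branch_limit_distr \<theta>) x"
    unfolding cdf_branch_limit_distr[OF assms] by (rule LIMSEQ_imp_Suc)
qed

text \<open>On the region the base 1 - sum y_j is positive, so its power with exponent 0 is 1. For x
  > 1 the constant branch of \<open>F_one\<close> agrees by \<open>F_theta_ge_1\<close>.\<close>

lemma F_one_eq: "F_one x = branch_limit_cdf 1 x"
proof -
  have "F_theta 1 x = 1 + (\<Sum>m. let k = Suc m in (- 1) ^ k / fact k *
      (LINT y:simplex_region k (1 / x)|Pi\<^sub>M {1..k} (\<lambda>_. lborel). 1 / (\<Prod>j=1..k. y j)))" if "x > 0"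
  proof -
    have "(LINT y:simplex_region k (1 / x)|Pi\<^sub>M {1..k} (\<lambda>_. lborel).
        (1 - (\<Sum>j=1..k. y j)) powr (1 - 1) / (\<Prod>j=1..k. y j)) =
      (LINT y:simplex_region k (1 / x)|Pi\<^sub>M {1..k} (\<lambda>_. lborel). 1 / (\<Prod>j=1..k. y j))" for k
      unfolding set_lebesgue_integral_def
      by (intro Bochner_Integration.integral_cong) (auto simp: simplex_region_def indicator_def)
    then show ?thesis
      using F_theta_eq_suminf[of 1 x] that by (simp only: zero_less_one Let_def)
  qed
  then show ?thesis
    using F_theta_ge_1[of 1 x] by (auto simp: F_one_def branch_limit_cdf_def)
qed

lemma limit_term_1:
  assumes "0 < c" "c \<le> 1"
  shows "limit_term 1 1 c = - ln c"
proof -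
  interpret product_sigma_finite "\<lambda>_::nat. lborel :: real measure"
    by standard
  let ?g = "\<lambda>t::real. if c < t \<and> t < 1 then 1 / t else 0"
  have "limit_density 1 c 1 = (\<lambda>y. ?g (y 1))"
    using assms by (auto simp: limit_density_def)
  then have "limit_term 1 1 c = (LINT y|Pi\<^sub>M {1::nat} (\<lambda>_. lborel). ?g (y 1))"
    by (simp add: limit_term_def del: One_nat_def)
  also have "\<dots> = (LINT t|lborel. ?g t)"
    by (rule product_integral_singleton) measurable
  also have "\<dots> = (LINT t|lborel. 1 / t * indicator {c..1} t)"
  proof (rule integral_cong_AE)
    show "AE t in lborel. ?g t = 1 / t * indicator {c..1} t"
      using AE_lborel_singleton[of c] AE_lborel_singleton[of 1]
      by eventually_elim (auto simp: indicator_def)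
  qed measurable
  also have "\<dots> = ln 1 - ln c"
    using assms by (intro integral_FTC_Icc_nonneg) (auto intro!: derivative_eq_intros)
  finally show ?thesis
    by simp
qed

text \<open>Two branches cannot both hold more than half of the nodes; in the limit this means that
  for c \<ge> 1/2 the series stops after k = 1.\<close>

lemma F_theta_1_eq:
  assumes "1 / 2 \<le> c" "c \<le> 1"
  shows "F_theta 1 c = 1 + ln c"
proof -
  have "limit_term 1 (Suc 0) c = - ln c"
    using limit_term_1[of c] assms by simp
  then show ?thesis
    using F_theta_eq[of 1 c 1] assms by (simp add: limit_term_def[of _ 0])
qed

text \<open>
  On \<open>(1/2, 1]\<close> the limit law has density \<open>1 / x\<close>, so this part alone contributes \<open>1/2\<close> to
  the expectation; the proof compares with lower Riemann sums.
\<close>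

lemma expectation_branch_limit_distr_1:
  "prob_space.expectation (branch_limit_distr 1) (\<lambda>x. x) \<ge> 1 / 2"
proof -
  interpret real_distribution "branch_limit_distr 1"
    by (rule real_distribution_branch_limit_distr) simp
  have cdf: "cdf (branch_limit_distr 1) = branch_limit_cdf 1"
    by (rule cdf_branch_limit_distr) simp
  \<comment> \<open>The law lives on (0, 1], which gives integrability and allows the part outside
    (1/2, 1] to be discarded as nonnegative.\<close>
  have "prob {..0} = 0" "prob {..1} = 1"
    using fun_cong[OF cdf, of 0] fun_cong[OF cdf, of 1] F_theta_ge_1[of 1 1]
    by (simp_all add: cdf_def branch_limit_cdf_def)
  then have "AE x in branch_limit_distr 1. x \<notin> {..0}" "AE x in branch_limit_distr 1. x \<in> {..1}"
    using AE_prob_1[of "{..1}"] prob_eq_0[of "{..0}"] by auto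
  then have AE: "AE x in branch_limit_distr 1. 0 < x \<and> x \<le> 1"
    by eventually_elim auto
  have int: "integrable (branch_limit_distr 1) (\<lambda>x. x)"
    by (rule integrable_const_bound[of _ 1]) (use AE in \<open>auto elim: eventually_mono\<close>)
  have bound: "expectation (\<lambda>x. x) \<ge> 1 / 2 - 1 / (2 * real N)" if N: "N > 0" for N :: nat
  proof -
    \<comment> \<open>Division points of [1/2, 1] into \<open>N\<close> cells of width 1/(2N). Each
      cell will contribute at least (1 - 1/N)/(2N) to the expectation.\<close>
    define c where "c i = 1 / 2 + real i / (2 * real N)" for i :: nat
    have c: "1 / 2 \<le> c i" "c i < c (Suc i)" "c (Suc i) = c i + 1 / (2 * real N)" for i
      using N by (simp_all add: c_def field_simps)
    have c1: "c i \<le> 1" if "i \<le> N" for i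
      using N that by (simp add: c_def field_simps)
    have disj: "disjoint_family_on (\<lambda>i. {c i<..c (Suc i)}) {..<N}"
      unfolding disjoint_family_on_def
    proof (intro ballI impI)
      have "incseq c"
        using c(2) by (intro incseq_SucI less_imp_le)
      then have "c (Suc i) \<le> c j" if "i < j" for i j
        using that by (auto simp: incseq_def)
      then show "{c i<..c (Suc i)} \<inter> {c j<..c (Suc j)} = {}" if "i \<noteq> j" for i j
        using that by (cases i j rule: linorder_cases) force+
    qed
    have le: "(\<Sum>i<N. c i * indicator {c i<..c (Suc i)} x) \<le> x" if "x > 0" for x
    proof -
      have "(\<Sum>i<N. c i * indicator {c i<..c (Suc i)} x) \<le> (\<Sum>i<N. x * indicator {c i<..c (Suc i)} x)"
        by (intro sum_mono) (auto simp: indicator_def)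
      also have "\<dots> = x * indicator (\<Union>i<N. {c i<..c (Suc i)}) x"
        by (simp add: indicator_UN_disjoint[OF _ disj] sum_distrib_left)
      also have "\<dots> \<le> x"
        using that by (auto simp: indicator_def)
      finally show ?thesis .
    qed
    have "1 / 2 - 1 / (2 * real N) = (\<Sum>i<N. (1 - 1 / real N) / (2 * real N))"
      using N by (simp add: field_simps)
    also have "\<dots> \<le> (\<Sum>i<N. c i * prob {c i<..c (Suc i)})"
    proof (rule sum_mono)
      fix i assume "i \<in> {..<N}"
      then have i: "c i \<le> 1" "c (Suc i) \<le> 1"
        using c1 by auto
      have "prob {c i<..c (Suc i)} = ln (c (Suc i)) - ln (c i)"
        using cdf_diff_eq[of "c i" "c (Suc i)"] c[of i] c(1)[of "Suc i"] i
        by (simp add: cdf branch_limit_cdf_def F_theta_1_eq)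
      \<comment> \<open>The inequality ln z \<le> z - 1, taken at the ratio of neighbouring division
        points, bounds the logarithmic increment from below.\<close>
      also have "\<dots> \<ge> (c (Suc i) - c i) / c (Suc i)"
        using ln_le_minus_one[of "c i / c (Suc i)"] c(1)[of i] c(1)[of "Suc i"]
        by (simp add: ln_div diff_divide_distrib)
      finally have "c i * ((c (Suc i) - c i) / c (Suc i)) \<le> c i * prob {c i<..c (Suc i)}"
        using c(1)[of i] by (intro mult_left_mono) auto
      \<comment> \<open>The right division point is at least 1/2, so the width 1/(2N) is at most 1/N
        times it, and neighbouring points have ratio at least 1 - 1/N.\<close>
      moreover have "(1 - 1 / real N) / (2 * real N) \<le> c i / c (Suc i) * (1 / (2 * real N))"
      proof -
        have "(1 / (2 * real N)) / c (Suc i) \<le> (1 / (2 * real N)) / (1 / 2)"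
          using c(1)[of "Suc i"] N by (intro divide_left_mono) auto
        then have "1 - 1 / real N \<le> 1 - (c (Suc i) - c i) / c (Suc i)"
          by (simp add: c(3))
        also have "\<dots> = c i / c (Suc i)"
          using c(1)[of "Suc i"] by (simp add: field_simps)
        finally have "(1 - 1 / real N) * (1 / (2 * real N)) \<le> c i / c (Suc i) * (1 / (2 * real N))"
          by (rule mult_right_mono) simp
        then show ?thesis
          by simp
      qed
      moreover have "c (Suc i) - c i = 1 / (2 * real N)"
        by (simp add: c(3))
      then have "c i * ((c (Suc i) - c i) / c (Suc i)) = c i / c (Suc i) * (1 / (2 * real N))"
        by simp
      ultimately show "(1 - 1 / real N) / (2 * real N) \<le> c i * prob {c i<..c (Suc i)}"
        by linarith
    qed
    also have "\<dots> = expectation (\<lambda>x. \<Sum>i<N. c i * indicator {c i<..c (Suc i)} x)"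
      by (subst Bochner_Integration.integral_sum) (auto intro!:
        integrable_real_mult_indicator simp: emeasure_eq_measure)
    also have "\<dots> \<le> expectation (\<lambda>x. x)"
    proof (rule integral_mono_AE)
      show "integrable (branch_limit_distr 1) (\<lambda>x. \<Sum>i<N. c i * indicator {c i<..c (Suc i)} x)"
        by (intro Bochner_Integration.integrable_sum integrable_mult_right integrable_real_indicator)
          (auto simp: emeasure_eq_measure)
      show "AE x in branch_limit_distr 1. (\<Sum>i<N. c i * indicator {c i<..c (Suc i)} x) \<le> x"
        using AE by eventually_elim (use le in auto)
    qed (rule int)
    finally show ?thesis .
  qed
  have "(\<lambda>N. 1 / 2 - 1 / (2 * real N)) \<longlonglongrightarrow> 1 / 2"
    by real_asymp
  then show ?thesis
    by (rule LIMSEQ_le_const2) (use bound in \<open>auto intro!: exI[of _ 1]\<close>)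
qed

theorem theorem4p1:
  "(\<forall>\<theta>::real. \<theta> > 0 \<longrightarrow>
      (\<exists>M. real_distribution M \<and>
         weak_conv_m (\<lambda>n. distr (measure_pmf (hoppe_tree \<theta> n)) borel
                            (\<lambda>T. real (largest_branch n T) / real n)) M \<and>
         (\<forall>x. cdf M x = (if x > 0 then F_theta \<theta> x else 0))))
   \<and> (\<exists>M. real_distribution M \<and>
         weak_conv_m (\<lambda>n. distr (measure_pmf (uniform_recursive_tree n)) borel
                            (\<lambda>T. real (largest_branch n T) / real n)) M \<and>
         (\<forall>x. cdf M x = F_one x) \<and>
         prob_space.expectation M (\<lambda>x. x) \<ge> 1 / 2)
   \<and> (\<forall>c::real. c \<in> {1/2..1} \<longrightarrow>
         (\<lambda>n. measure_pmf.prob (uniform_recursive_tree n)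
                {T. real (largest_branch n T) \<le> c * real n})
           \<longlonglongrightarrow> 1 - ln (inverse c))"
proof (intro conjI allI impI)
  fix \<theta> :: real
  assume "\<theta> > 0"
  then show "\<exists>M. real_distribution M \<and>
      weak_conv_m (\<lambda>n. distr (measure_pmf (hoppe_tree \<theta> n)) borel
        (\<lambda>T. real (largest_branch n T) / real n)) M \<and>
      (\<forall>x. cdf M x = (if x > 0 then F_theta \<theta> x else 0))"
    by (intro exI[of _ "branch_limit_distr \<theta>"] conjI real_distribution_branch_limit_distr weak_conv_largest_branch)
      (simp_all add: cdf_branch_limit_distr branch_limit_cdf_def)
next
  show "\<exists>M. real_distribution M \<and>
      weak_conv_m (\<lambda>n. distr (measure_pmf (uniform_recursive_tree n)) borel
        (\<lambda>T. real (largest_branch n T) / real n)) M \<and>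
      (\<forall>x. cdf M x = F_one x) \<and> prob_space.expectation M (\<lambda>x. x) \<ge> 1 / 2"
    unfolding uniform_recursive_tree_eq_hoppe_tree
    by (intro exI[of _ "branch_limit_distr 1"] conjI real_distribution_branch_limit_distr
        weak_conv_largest_branch expectation_branch_limit_distr_1)
      (simp_all add: cdf_branch_limit_distr F_one_eq)
next
  fix c :: real
  assume "c \<in> {1/2..1}"
  then show "(\<lambda>n. measure_pmf.prob (uniform_recursive_tree n)
      {T. real (largest_branch n T) \<le> c * real n}) \<longlonglongrightarrow> 1 - ln (inverse c)"
    unfolding uniform_recursive_tree_eq_hoppe_tree
    using branch_cdf_tendsto[of 1 c] by (simp add: F_theta_1_eq ln_inverse)
qed

end
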